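(* Let $F$ be a free group of finite rank with fixed basis $A$. Let $t\in F$ (viewed as a reduced word over $\tilde A$) and let $L\subseteq\tilde A^*$ be a rational (regular) language. The following conditions are equivalent. \begin{itemize} \item[(1)] There exists a finitely generated subgroup $H$ of $F$ such that $t=\mathsf{t}_H(1)$ and $L=\widetilde L_{\tau_H(1)}(H)$. \item[(2)] There exists a finitely generated $\mathsf{fi}$-maximal subgroup $H$ of $F$ such that $t=\mathsf{t}_H(1)$ and $L=\widetilde L_{\tau_H(1)}(H)$. \item[(3)] $L$ is accepted by an i-automaton with all states accepting and such that, for each state $p$, there exist transitions $(p,a,q)$ and $(p,b,r)$ for at least two distinct letters $a,b\in\tilde A$. In addition, if $t$ is not the empty word, then $t=t'a$ for a letter $a\in\tilde A$ such that $\bar a\notin L$. \item[(3')] The minimal automaton of $L$ is an i-automaton with all states accepting and such that, for each state $p$, there exist transitions $(p,a,q)$ and $(p,b,r)$ for at least two distinct letters $a,b\in\tilde A$. In addition, if $t$ is not the empty word, then $t=t'a$ for a letter $a\in\tilde A$ such that $\bar a\notin L$. \item[(4)] $t$ and $L$ satisfy the following conditions: (4.1) $L$ is closed under taking prefixes; (4.2) if $u,v\in L$, then $u\bar u v\in L$; (4.3) if $uv\bar v w\in L$, then $uw\in L$; (4.4) if $ua\in L$ with $a\in\tilde A$, then $uab\in L$ for some $b\in\tilde A$ such that $b\neq\bar a$; (4.5) if $t$ is not the empty word, then $t=t'a$ for a letter $a\in\tilde A$ such that $\bar a\notin L$. \end{itemize}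
   Context: Words: $F$ is a free group with finite basis $A$; $\bar A=\{\bar a: a\in A\}$ is a disjoint copy of $A$ and $\tilde A=A\cup\bar A$, with $\bar{\bar a}=a$ and $\overline{ua}=\bar a\,\bar u$ for words. Elements of $F$ are identified with reduced words over $\tilde A$ (no factor $a\bar a$, $a\in\tilde A$). Stallings graph: each finitely generated $H\le F$ has a unique representation $\mathcal{A}(H)=(\Gamma(H),1)$, where $\Gamma(H)$ is a finite connected directed graph with edges labeled by $A$ and $1$ is a designated vertex, such that (i) for each $a\in A$ every vertex is the source of at most one and the target of at most one $a$-labeled edge; (ii) every vertex except possibly $1$ has degree (in-degree plus out-degree) at least $2$; (iii) a reduced word is in $H$ iff it labels a loop at $1$. Here an edge $(p,a,q)$, $a\in A$, is read as $p\xrightarrow{a}q$ and $q\xrightarrow{\bar a}p$, so paths are labeled by words over $\tilde A$. Core and tail: $H$ is called cyclically reduced if every vertex of $\Gamma(H)$ has degree at least $2$; in that case $\mathsf{cc}(\Gamma(H))=\Gamma(H)$, $\mathsf{t}_H(1)$ is the empty word and $\tau_H(1)=1$. If $H$ is not cyclically reduced, then vertex $1$ has degree $1$ and $\Gamma(H)$ consists of two parts: the tail, which contains $1$ and all degree-$2$ vertices that can be connected to $1$ through other degree-$2$ vertices, and the rest of $\Gamma(H)$, which is the core $\mathsf{cc}(\Gamma(H))$; then $\mathsf{t}_H(1)$ is the shortest word labeling a path from $1$ to a vertex of $\mathsf{cc}(\Gamma(H))$, and $\tau_H(1)$ is the vertex of $\mathsf{cc}(\Gamma(H))$ thus reached.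 Languages: for a vertex $p$ of $\mathsf{cc}(\Gamma(H))$, $\widetilde L_p(H)$ is the set of (possibly non-reduced) words in $\tilde A^*$ labeling a path in $\mathsf{cc}(\Gamma(H))$ starting at $p$. $\mathsf{fi}$-maximal: a finitely generated subgroup $G$ of $F$ is $\mathsf{fi}$-maximal if no subgroup of $F$ properly containing $G$ contains $G$ with finite index. Automata: automata are finite, deterministic and possibly partial (at most one transition $(p,a,q)$ for given $p,a$), of the form $(Q,i,E,T)$ with state set $Q$, initial state $i$, transitions $E\subseteq Q\times\tilde A\times Q$ and accepting states $T$. An i-automaton is such an automaton in which $(p,a,q)\in E$ iff $(q,\bar a,p)\in E$, for all states $p,q$ and $a\in A$. The minimal automaton of $L$ is the trim minimal deterministic automaton (no sink state), obtained from a trim deterministic automaton accepting $L$ by identifying the pairs of states $p,q$ from which the same language is accepted.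
   Formalization: Condition (4) is supplemented by the requirement that L contain a nonempty word: the empty language and the language consisting only of the empty word satisfy (4.1)–(4.5) but not (3), so the stated equivalence with (4) fails for them. *)

theory Defs
  imports "HOL-Algebra.Coset" "HOL-Algebra.Generated_Groups"
begin

section \<open>Words and the free group\<close>

text \<open>
  The disjoint copy of the basis is rendered by the sum type: \<open>Inl a\<close> is the letter \<open>a\<close> and
  \<open>Inr a\<close> is its formal inverse.
\<close>

definition letters :: "'a set \<Rightarrow> ('a + 'a) set" where
  "letters A = A <+> A"

fun bar :: "'a + 'a \<Rightarrow> 'a + 'a" where
  "bar (Inl a) = Inr a"
| "bar (Inr a) = Inl a"

definition bar_word :: "('a + 'a) list \<Rightarrow> ('a + 'a) list" where
  "bar_word w = rev (map bar w)"

definition reduced :: "('a + 'a) list \<Rightarrow> bool" where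
  "reduced w \<longleftrightarrow> \<not> (\<exists>u x v. w = u @ [x, bar x] @ v)"

fun cancel :: "'a + 'a \<Rightarrow> ('a + 'a) list \<Rightarrow> ('a + 'a) list" where
  "cancel x [] = [x]"
| "cancel x (y # w) = (if y = bar x then w else x # y # w)"

definition reduce :: "('a + 'a) list \<Rightarrow> ('a + 'a) list" where
  "reduce w = foldr cancel w []"

definition free_group :: "'a set \<Rightarrow> ('a + 'a) list monoid" where
  "free_group A =
     \<lparr> carrier = {w \<in> lists (letters A). reduced w},
       monoid.mult = (\<lambda>u v. reduce (u @ v)),
       one = [] \<rparr>"

lemma bar_bar [simp]: "bar (bar x) = x"
  by (cases x) auto

lemma bar_in_letters [simp]: "bar x \<in> letters A \<longleftrightarrow> x \<in> letters A"
  by (cases x) (auto simp: letters_def)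

lemma reduced_Nil [simp]: "reduced []"
  by (simp add: reduced_def)

lemma reduced_Cons:
  "reduced (x # w) \<longleftrightarrow> reduced w \<and> (w = [] \<or> hd w \<noteq> bar x)"
proof
  assume r: "reduced (x # w)"
  have "reduced w"
    unfolding reduced_def
  proof
    assume "\<exists>u y v. w = u @ [y, bar y] @ v"
    then obtain u y v where "w = u @ [y, bar y] @ v" by blast
    then have "x # w = (x # u) @ [y, bar y] @ v" by simp
    with r show False unfolding reduced_def by blast
  qed
  moreover have "hd w \<noteq> bar x" if "w \<noteq> []"
  proof
    assume "hd w = bar x"
    with that have "x # w = [] @ [x, bar x] @ tl w" by (cases w) auto
    with r show False unfolding reduced_def by blast
  qed
  ultimately show "reduced w \<and> (w = [] \<or> hd w \<noteq> bar x)" by blast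
next
  assume r: "reduced w \<and> (w = [] \<or> hd w \<noteq> bar x)"
  show "reduced (x # w)"
    unfolding reduced_def
  proof
    assume "\<exists>u y v. x # w = u @ [y, bar y] @ v"
    then obtain u y v where e: "x # w = u @ [y, bar y] @ v" by blast
    show False
    proof (cases u)
      case Nil
      with e r show False by auto
    next
      case (Cons z u')
      with e have "w = u' @ [y, bar y] @ v" by simp
      with r show False unfolding reduced_def by blast
    qed
  qed
qed

lemma reduced_cancel: "reduced w \<Longrightarrow> reduced (cancel x w)"
  by (cases w) (auto simp: reduced_Cons)

lemma reduced_foldr_cancel: "reduced w \<Longrightarrow> reduced (foldr cancel u w)"
  by (induction u) (auto intro: reduced_cancel)

lemma cancel_eq_Cons: "reduced (x # w) \<Longrightarrow> cancel x w = x # w"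
  by (cases w) (auto simp: reduced_Cons)

lemma reduce_eq_self: "reduced w \<Longrightarrow> reduce w = w"
  unfolding reduce_def
  by (induction w) (auto simp: cancel_eq_Cons, auto simp: reduced_Cons cancel_eq_Cons)

lemma cancel_cancel_bar: "reduced w \<Longrightarrow> cancel x (cancel (bar x) w) = w"
  by (cases w) (auto simp: cancel_eq_Cons)

lemma foldr_cancel_cancel:
  "reduced w \<Longrightarrow> foldr cancel (cancel x u) w = cancel x (foldr cancel u w)"
  by (cases u) (auto simp: cancel_cancel_bar reduced_foldr_cancel)

lemma foldr_cancel_reduce:
  "reduced w \<Longrightarrow> foldr cancel (reduce u) w = foldr cancel u w"
  unfolding reduce_def by (induction u) (auto simp: foldr_cancel_cancel)

lemma reduced_reduce: "reduced (reduce w)"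
  by (simp add: reduce_def reduced_foldr_cancel)

lemma reduce_append: "reduce (u @ v) = foldr cancel u (reduce v)"
  by (simp add: reduce_def)

lemma reduce_assoc: "reduce (reduce (u @ v) @ w) = reduce (u @ reduce (v @ w))"
proof -
  have "reduce (reduce (u @ v) @ w) = foldr cancel (u @ v) (reduce w)"
    by (simp only: reduce_append[of _ w] foldr_cancel_reduce reduced_reduce)
  also have "\<dots> = reduce (u @ reduce (v @ w))"
    by (simp add: reduce_append[of u] reduce_append[of v] reduce_eq_self
        reduced_foldr_cancel reduced_reduce)
  finally show ?thesis .
qed

lemma set_cancel: "set (cancel x w) \<subseteq> insert x (set w)"
  by (cases w) auto

lemma set_reduce: "set (reduce w) \<subseteq> set w"
proof (induction w)
  case Nil
  show ?case by (simp add: reduce_def)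
next
  case (Cons x w)
  then show ?case
    using set_cancel[of x "reduce w"] unfolding reduce_def foldr_Cons o_apply list.set by blast
qed

lemma reduce_in_lists: "w \<in> lists S \<Longrightarrow> reduce w \<in> lists S"
  using set_reduce[of w] by (auto simp: lists_eq_set)

lemma reduce_bar_word: "reduce (bar_word w @ w) = []"
proof (induction w)
  case Nil
  show ?case by (simp add: bar_word_def reduce_def)
next
  case (Cons x w)
  have "cancel (bar x) (cancel x (reduce w)) = reduce w"
    using cancel_cancel_bar[OF reduced_reduce, of "bar x" w] by simp
  with Cons show ?case by (simp add: bar_word_def reduce_def)
qed

lemma group_free_group: "group (free_group A)"
proof (rule groupI)
  fix x y z
  assume x: "x \<in> carrier (free_group A)" and y: "y \<in> carrier (free_group A)"
  have "x @ y \<in> lists (letters A)"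
    using x y by (simp add: free_group_def)
  then show "x \<otimes>\<^bsub>free_group A\<^esub> y \<in> carrier (free_group A)"
    using reduce_in_lists by (simp add: free_group_def reduced_reduce del: in_lists_conv_set append_in_lists_conv)
  show "x \<otimes>\<^bsub>free_group A\<^esub> y \<otimes>\<^bsub>free_group A\<^esub> z = x \<otimes>\<^bsub>free_group A\<^esub> (y \<otimes>\<^bsub>free_group A\<^esub> z)"
    by (simp add: free_group_def reduce_assoc)
next
  fix x assume x: "x \<in> carrier (free_group A)"
  show "\<one>\<^bsub>free_group A\<^esub> \<otimes>\<^bsub>free_group A\<^esub> x = x"
    using x by (simp add: free_group_def reduce_eq_self)
  have "bar_word x \<in> lists (letters A)"
    using x by (auto simp: free_group_def bar_word_def)
  then have "reduce (bar_word x) \<in> carrier (free_group A)"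
    using reduce_in_lists by (simp add: free_group_def reduced_reduce del: in_lists_conv_set)
  moreover have "reduce (reduce (bar_word x) @ x) = []"
    by (simp only: reduce_append[of _ x] foldr_cancel_reduce reduced_reduce)
      (simp only: reduce_append[symmetric] reduce_bar_word)
  ultimately show "\<exists>y\<in>carrier (free_group A). y \<otimes>\<^bsub>free_group A\<^esub> x = \<one>\<^bsub>free_group A\<^esub>"
    by (intro bexI[of _ "reduce (bar_word x)"]) (simp_all add: free_group_def)
qed (simp add: free_group_def)

definition fin_gen_subgroup :: "'a set \<Rightarrow> ('a + 'a) list set \<Rightarrow> bool" where
  "fin_gen_subgroup A H \<longleftrightarrow>
     subgroup H (free_group A) \<and>
     (\<exists>S. finite S \<and> S \<subseteq> carrier (free_group A) \<and> H = generate (free_group A) S)"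

definition fi_maximal :: "'a set \<Rightarrow> ('a + 'a) list set \<Rightarrow> bool" where
  "fi_maximal A G \<longleftrightarrow>
     fin_gen_subgroup A G \<and>
     \<not> (\<exists>K. subgroup K (free_group A) \<and> G \<subset> K \<and>
            finite (rcosets\<^bsub>(free_group A)\<lparr>carrier := K\<rparr>\<^esub> G))"


section \<open>Labeled graphs and Stallings graphs\<close>

fun path :: "('q \<times> 'l \<times> 'q) set \<Rightarrow> 'q \<Rightarrow> 'l list \<Rightarrow> 'q \<Rightarrow> bool" where
  "path E p [] q \<longleftrightarrow> p = q"
| "path E p (x # w) q \<longleftrightarrow> (\<exists>r. (p, x, r) \<in> E \<and> path E r w q)"

record ('v, 'a) pointed_graph =
  verts :: "'v set"
  edges :: "('v \<times> 'a \<times> 'v) set"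
  base :: 'v

text \<open>Each edge \<open>(p, a, q)\<close> is read as \<open>a\<close> from \<open>p\<close> to \<open>q\<close> and as the inverse of \<open>a\<close> from \<open>q\<close> to \<open>p\<close>.\<close>

definition two_way :: "('v \<times> 'a \<times> 'v) set \<Rightarrow> ('v \<times> ('a + 'a) \<times> 'v) set" where
  "two_way E = {(p, Inl a, q) | p a q. (p, a, q) \<in> E} \<union> {(q, Inr a, p) | p a q. (p, a, q) \<in> E}"

text \<open>A loop at \<open>v\<close> contributes 2.\<close>

definition degree :: "('v, 'a) pointed_graph \<Rightarrow> 'v \<Rightarrow> nat" where
  "degree \<Gamma> v = card {(p, a, q) \<in> edges \<Gamma>. q = v} + card {(p, a, q) \<in> edges \<Gamma>. p = v}"

text \<open>
  \<open>stallings_graph A H \<Gamma>\<close> says that \<open>\<Gamma>\<close> is (a copy of) the Stallings graph of \<open>H\<close>, which is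
  characterised up to isomorphism of pointed labeled graphs by the conditions below.
\<close>

definition stallings_graph ::
    "'a set \<Rightarrow> ('a + 'a) list set \<Rightarrow> ('v, 'a) pointed_graph \<Rightarrow> bool" where
  "stallings_graph A H \<Gamma> \<longleftrightarrow>
     finite (verts \<Gamma>) \<and> edges \<Gamma> \<subseteq> verts \<Gamma> \<times> A \<times> verts \<Gamma> \<and> base \<Gamma> \<in> verts \<Gamma> \<and>
     (\<forall>p\<in>verts \<Gamma>. \<forall>q\<in>verts \<Gamma>. \<exists>w. path (two_way (edges \<Gamma>)) p w q) \<and>
     (\<forall>p a q q'. (p, a, q) \<in> edges \<Gamma> \<and> (p, a, q') \<in> edges \<Gamma> \<longrightarrow> q = q') \<and>
     (\<forall>p p' a q. (p, a, q) \<in> edges \<Gamma> \<and> (p', a, q) \<in> edges \<Gamma> \<longrightarrow> p = p') \<and>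
     (\<forall>v\<in>verts \<Gamma> - {base \<Gamma>}. degree \<Gamma> v \<ge> 2) \<and>
     (\<forall>w\<in>lists (letters A). reduced w \<longrightarrow>
        (w \<in> H \<longleftrightarrow> path (two_way (edges \<Gamma>)) (base \<Gamma>) w (base \<Gamma>)))"

definition cyclically_reduced :: "('v, 'a) pointed_graph \<Rightarrow> bool" where
  "cyclically_reduced \<Gamma> \<longleftrightarrow> (\<forall>v\<in>verts \<Gamma>. degree \<Gamma> v \<ge> 2)"

text \<open>Only meaningful if the graph is not cyclically reduced.\<close>

inductive_set tail_verts :: "('v, 'a) pointed_graph \<Rightarrow> 'v set" for \<Gamma> where
  base: "base \<Gamma> \<in> tail_verts \<Gamma>"
| step: "p \<in> tail_verts \<Gamma> \<Longrightarrow> (p, x, q) \<in> two_way (edges \<Gamma>) \<Longrightarrow> degree \<Gamma> q = 2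
         \<Longrightarrow> q \<in> tail_verts \<Gamma>"

definition core_verts :: "('v, 'a) pointed_graph \<Rightarrow> 'v set" where
  "core_verts \<Gamma> = (if cyclically_reduced \<Gamma> then verts \<Gamma> else verts \<Gamma> - tail_verts \<Gamma>)"

definition core_edges :: "('v, 'a) pointed_graph \<Rightarrow> ('v \<times> 'a \<times> 'v) set" where
  "core_edges \<Gamma> = edges \<Gamma> \<inter> (core_verts \<Gamma> \<times> UNIV \<times> core_verts \<Gamma>)"

text \<open>
  \<open>tail_word \<Gamma> t p\<close> says that \<open>t\<close> is the word \<open>t\<^sub>H(1)\<close> and \<open>p\<close> the vertex \<open>\<tau>\<^sub>H(1)\<close>. It is a
  relation because the Stallings graph of the trivial subgroup, a single vertex without edges,
  has an empty core, so that there is no such word and no such vertex.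
\<close>

definition tail_word :: "('v, 'a) pointed_graph \<Rightarrow> ('a + 'a) list \<Rightarrow> 'v \<Rightarrow> bool" where
  "tail_word \<Gamma> t p \<longleftrightarrow>
     (if cyclically_reduced \<Gamma> then t = [] \<and> p = base \<Gamma>
      else p \<in> core_verts \<Gamma> \<and> path (two_way (edges \<Gamma>)) (base \<Gamma>) t p \<and>
           (\<forall>s. \<forall>q\<in>core_verts \<Gamma>. path (two_way (edges \<Gamma>)) (base \<Gamma>) s q \<longrightarrow> length t \<le> length s))"

definition core_language :: "('v, 'a) pointed_graph \<Rightarrow> 'v \<Rightarrow> ('a + 'a) list set" where
  "core_language \<Gamma> p = {w. \<exists>q. path (two_way (core_edges \<Gamma>)) p w q}"

text \<open>
  \<open>tail_and_core_language A H t L\<close> says that \<open>t = t\<^sub>H(1)\<close> and that \<open>L\<close> is the language of all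
  words labeling a path in the core starting at \<open>\<tau>\<^sub>H(1)\<close>. The Stallings graph is finite, so its
  vertices may be taken to be natural numbers.
\<close>

definition tail_and_core_language ::
    "'a set \<Rightarrow> ('a + 'a) list set \<Rightarrow> ('a + 'a) list \<Rightarrow> ('a + 'a) list set \<Rightarrow> bool" where
  "tail_and_core_language A H t L \<longleftrightarrow>
     (\<exists>(\<Gamma> :: (nat, 'a) pointed_graph) p.
        stallings_graph A H \<Gamma> \<and> tail_word \<Gamma> t p \<and> L = core_language \<Gamma> p)"


section \<open>Automata\<close>

record ('q, 'l) automaton =
  states :: "'q set"
  initial :: 'q
  transitions :: "('q \<times> 'l \<times> 'q) set"
  accepting :: "'q set"

definition automaton_over :: "'l set \<Rightarrow> ('q, 'l) automaton \<Rightarrow> bool" where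
  "automaton_over \<Sigma> M \<longleftrightarrow>
     finite (states M) \<and> initial M \<in> states M \<and>
     transitions M \<subseteq> states M \<times> \<Sigma> \<times> states M \<and> accepting M \<subseteq> states M \<and>
     (\<forall>p x q q'. (p, x, q) \<in> transitions M \<and> (p, x, q') \<in> transitions M \<longrightarrow> q = q')"

definition language_from :: "('q, 'l) automaton \<Rightarrow> 'q \<Rightarrow> 'l list set" where
  "language_from M p = {w. \<exists>q\<in>accepting M. path (transitions M) p w q}"

definition accepted_language :: "('q, 'l) automaton \<Rightarrow> 'l list set" where
  "accepted_language M = language_from M (initial M)"

definition rational_language :: "'l set \<Rightarrow> 'l list set \<Rightarrow> bool" where
  "rational_language \<Sigma> L \<longleftrightarrow>
     (\<exists>M :: (nat, 'l) automaton. automaton_over \<Sigma> M \<and> accepted_language M = L)"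

definition trim :: "('q, 'l) automaton \<Rightarrow> bool" where
  "trim M \<longleftrightarrow>
     (\<forall>p\<in>states M. (\<exists>w. path (transitions M) (initial M) w p) \<and>
                   (\<exists>w. \<exists>q\<in>accepting M. path (transitions M) p w q))"

definition state_equiv :: "('q, 'l) automaton \<Rightarrow> ('q \<times> 'q) set" where
  "state_equiv M =
     {(p, q). p \<in> states M \<and> q \<in> states M \<and> language_from M p = language_from M q}"

definition merge_states :: "('q, 'l) automaton \<Rightarrow> ('q set, 'l) automaton" where
  "merge_states M =
     \<lparr> states = states M // state_equiv M,
       initial = state_equiv M `` {initial M},
       transitions =
         {(state_equiv M `` {p}, x, state_equiv M `` {q}) | p x q. (p, x, q) \<in> transitions M},
       accepting = accepting M // state_equiv M \<rparr>"

text \<open>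
  The minimal automaton is determined up to isomorphism only: it does not depend, up to
  isomorphism, on the trim automaton whose states are merged. The empty language has none, since a
  trim automaton with an initial state accepts at least one word.
\<close>

definition minimal_automaton :: "'l set \<Rightarrow> 'l list set \<Rightarrow> (nat set, 'l) automaton \<Rightarrow> bool" where
  "minimal_automaton \<Sigma> L M \<longleftrightarrow>
     (\<exists>B :: (nat, 'l) automaton.
        automaton_over \<Sigma> B \<and> trim B \<and> accepted_language B = L \<and> M = merge_states B)"

definition i_automaton :: "'a set \<Rightarrow> ('q, 'a + 'a) automaton \<Rightarrow> bool" where
  "i_automaton A M \<longleftrightarrow>
     automaton_over (letters A) M \<and>
     (\<forall>p q. \<forall>a\<in>A. (p, Inl a, q) \<in> transitions M \<longleftrightarrow> (q, bar (Inl a), p) \<in> transitions M)"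

definition two_letters_everywhere :: "('q, 'l) automaton \<Rightarrow> bool" where
  "two_letters_everywhere M \<longleftrightarrow>
     (\<forall>p\<in>states M. \<exists>a b q r. a \<noteq> b \<and> (p, a, q) \<in> transitions M \<and> (p, b, r) \<in> transitions M)"

definition tail_compatible ::
    "'a set \<Rightarrow> ('a + 'a) list \<Rightarrow> ('a + 'a) list set \<Rightarrow> bool" where
  "tail_compatible A t L \<longleftrightarrow>
     (t \<noteq> [] \<longrightarrow> (\<exists>t'. \<exists>a\<in>letters A. t = t' @ [a] \<and> [bar a] \<notin> L))"

text \<open>
  An automaton in which every state is accepting and has two outgoing transitions accepts a
  nonempty word. On the other hand, closure under prefixes, under the insertion and the deletion of
  factors \<open>v @ bar_word v\<close> and under the extension of nonempty words also holds for the languages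
  \<open>{}\<close> and \<open>{[]}\<close>. A characterisation of \<open>L\<close> by these closure properties therefore has to
  exclude \<open>L \<subseteq> {[]}\<close>.
\<close>

lemma two_letters_everywhere_imp_nontrivial:
  assumes "automaton_over \<Sigma> M" "accepting M = states M" "two_letters_everywhere M"
  shows "\<not> accepted_language M \<subseteq> {[]}"
proof -
  have "initial M \<in> states M"
    using assms(1) by (simp add: automaton_over_def)
  then obtain x q where q: "(initial M, x, q) \<in> transitions M"
    using assms(3) unfolding two_letters_everywhere_def by meson
  then have "q \<in> accepting M" using assms unfolding automaton_over_def by auto
  with q have "[x] \<in> accepted_language M"
    by (auto simp: accepted_language_def language_from_def)
  then show ?thesis by blast
qed

end

theory Submission
  imports Defs
begin

text \<open>
  The core of a Stallings graph is an automaton as in (3) because the tail is joined to it by a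
  single edge, and the closure properties (4) can be read off from such an automaton. Conversely,
  under (4) the left quotients of \<open>L\<close> are the states of an automaton that is closed under
  reversing edges and in which distinct states have distinct languages. Attaching a path labeled
  \<open>t\<close> to its initial state \<open>i\<close> gives the Stallings graph of a subgroup \<open>H\<close>.

  This \<open>H\<close> is \<open>fi\<close>-maximal: let \<open>K\<close> contain \<open>H\<close> with finite index and let \<open>k \<in> K\<close>. Conjugating
  by \<open>t\<close>, we regard \<open>k\<close> as starting at \<open>i\<close>. If \<open>v \<in> L\<close>, then the reduced form \<open>u\<close> of \<open>k v\<close> can be
  extended by an arbitrarily long reduced path of the core, hence to an element of \<open>K\<close> in which \<open>u\<close>
  is followed by a suffix so long that the multiplication by a coset representative, which brings it
  to \<open>H\<close>, does not affect \<open>u\<close>. So \<open>u\<close> can be read from \<open>i\<close>. It follows that \<open>k\<close> leads from \<open>i\<close> to a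
  state with the same language as \<open>i\<close>, that is, to \<open>i\<close> itself, which means \<open>k \<in> H\<close>.
\<close>

section \<open>Reduced words and involutive graphs\<close>

lemma path_append: "path E p (u @ v) q \<longleftrightarrow> (\<exists>r. path E p u r \<and> path E r v q)"
  by (induction u arbitrary: p) auto

lemma path_mono: "path E p w q \<Longrightarrow> E \<subseteq> E' \<Longrightarrow> path E' p w q"
  by (induction w arbitrary: p) auto

lemma bar_eq_iff: "bar x = y \<longleftrightarrow> x = bar y"
  by auto

lemma bar_word_simps [simp]:
  "bar_word [] = []"
  "bar_word (x # w) = bar_word w @ [bar x]"
  "bar_word (u @ v) = bar_word v @ bar_word u"
  "bar_word (bar_word w) = w"
  "length (bar_word w) = length w"
  by (simp_all add: bar_word_def rev_map o_def)

lemma bar_word_in_lists [simp]: "bar_word w \<in> lists (letters A) \<longleftrightarrow> w \<in> lists (letters A)"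
  by (auto simp: bar_word_def)

lemma reduced_append:
  "reduced (u @ v) \<longleftrightarrow> reduced u \<and> reduced v \<and> (u = [] \<or> v = [] \<or> hd v \<noteq> bar (last u))"
  by (induction u) (auto simp: reduced_Cons)

lemma reduce_reduce [simp]:
  "reduce (reduce u) = reduce u"
  "reduce (reduce u @ v) = reduce (u @ v)"
  "reduce (u @ reduce v) = reduce (u @ v)"
  using foldr_cancel_reduce[OF reduced_reduce, of u v]
  by (simp_all add: reduce_eq_self reduced_reduce reduce_append[of u] reduce_append[of "reduce u"])

lemma reduce_append_bar_word [simp]: "reduce (w @ bar_word w) = []"
  using reduce_bar_word[of "bar_word w"] by simp

lemma reduce_Nil [simp]: "reduce [] = []"
  by (simp add: reduce_def)

text \<open>Equality in the group is equality of reduced forms, so this allows a factor inside a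
  product to be replaced by an equal one.\<close>

lemma reduce_mid_cong: "reduce v = reduce v' \<Longrightarrow> reduce (u @ v @ w) = reduce (u @ v' @ w)"
  by (metis reduce_reduce(2,3))

lemma reduce_delete:
  "reduce (u @ w @ bar_word w @ v) = reduce (u @ v)"
  "reduce (u @ bar_word w @ w @ v) = reduce (u @ v)"
  using reduce_mid_cong[of "w @ bar_word w" "[]" u v] reduce_mid_cong[of "bar_word w @ w" "[]" u v]
  by (simp_all add: reduce_bar_word)

lemma reduced_bar_word: "reduced w \<Longrightarrow> reduced (bar_word w)"
  by (induction w)
    (auto simp: reduced_append reduced_Cons bar_eq_iff hd_rev last_rev hd_map last_map bar_word_def)

text \<open>\<open>reduce\<close> consumes a word from its right end and cancels on the left. This
  is the mirror image: multiplying a reduced word by one letter on the right affects at most its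
  last letter.\<close>

lemma reduce_snoc:
  assumes "reduced u"
  shows "reduce (u @ [x]) = (if u \<noteq> [] \<and> last u = bar x then butlast u else u @ [x])"
proof (cases "u \<noteq> [] \<and> last u = bar x")
  case True
  then have u: "u = butlast u @ [bar x]" by (metis append_butlast_last_id)
  then have "reduced (butlast u)" using assms by (metis reduced_append)
  then show ?thesis
    using True reduce_delete(2)[of "butlast u" "[x]" "[]"]
    by (subst u) (simp add: reduce_eq_self)
next
  case False
  then have "reduced (u @ [x])"
    using assms by (auto simp: reduced_append reduced_Cons bar_eq_iff)
  with False show ?thesis by (auto simp: reduce_eq_self)
qed

text \<open>Each letter of \<open>z\<close> cancels at most one letter on its left, so
  \<open>z\<close> is used up before the cancellation gets past \<open>v\<close>. In the maximality
  proof, \<open>w\<close> is the part of a word that has to survive a multiplication by a short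
  element.\<close>

lemma reduce_append_short:
  assumes "reduced (w @ v)" "length z \<le> length v"
  shows "\<exists>y. reduce (w @ v @ z) = w @ y"
  using assms
proof (induction z arbitrary: v)
  case Nil
  then show ?case by (auto simp: reduce_eq_self)
next
  case (Cons x z)
  then have v: "v \<noteq> []" by auto
  have eq: "reduce (w @ v @ x # z) = reduce (reduce ((w @ v) @ [x]) @ z)" by simp
  show ?case
  proof (cases "last v = bar x")
    case True
    then have "reduce ((w @ v) @ [x]) = w @ butlast v"
      using v Cons.prems(1) by (subst reduce_snoc) (auto simp: butlast_append)
    moreover have "reduced (w @ butlast v)"
      using Cons.prems(1) v by (metis append_assoc append_butlast_last_id reduced_append)
    ultimately show ?thesis using eq Cons.IH[of "butlast v"] Cons.prems(2) by simp
  next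
    case False
    then have "reduce ((w @ v) @ [x]) = w @ v @ [x]"
      using v Cons.prems(1) by (subst reduce_snoc) auto
    moreover have "reduced (w @ v @ [x])"
      using False v Cons.prems(1) reduced_append[of "w @ v" "[x]"]
      by (auto simp: reduced_Cons bar_eq_iff)
    ultimately show ?thesis using eq Cons.IH[of "v @ [x]"] Cons.prems(2) by simp
  qed
qed

section \<open>The operations of the free group in terms of words, and the subgroup of loop
  labels\<close>

lemma carrier_free_group: "w \<in> carrier (free_group A) \<longleftrightarrow> w \<in> lists (letters A) \<and> reduced w"
  by (simp add: free_group_def)

lemma mult_free_group [simp]: "u \<otimes>\<^bsub>free_group A\<^esub> v = reduce (u @ v)"
  by (simp add: free_group_def)

lemma one_free_group [simp]: "\<one>\<^bsub>free_group A\<^esub> = []"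
  by (simp add: free_group_def)

lemma inv_free_group:
  assumes "w \<in> carrier (free_group A)"
  shows "inv\<^bsub>free_group A\<^esub> w = bar_word w"
  using assms group.inv_equality[OF group_free_group, of A "bar_word w" w]
  by (simp add: carrier_free_group reduce_bar_word reduced_bar_word del: in_lists_conv_set)

text \<open>Every edge is stored together with its reverse. Determinism then also makes the source
  of an edge unique for given letter and target, so the condition is that of a folded graph.\<close>

locale involutive_graph =
  fixes E :: "('q \<times> ('a + 'a) \<times> 'q) set"
  assumes edge_bar: "(p, x, q) \<in> E \<Longrightarrow> (q, bar x, p) \<in> E"
    and edge_unique: "(p, x, q) \<in> E \<Longrightarrow> (p, x, q') \<in> E \<Longrightarrow> q = q'"
begin

lemma path_unique: "path E p w q \<Longrightarrow> path E p w q' \<Longrightarrow> q = q'"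
  by (induction w arbitrary: p) (auto dest: edge_unique)

lemma path_bar_word: "path E p w q \<Longrightarrow> path E q (bar_word w) p"
  by (induction w arbitrary: p) (auto simp: path_append intro: edge_bar)

text \<open>An edge labeled \<open>x\<close> followed by one labeled \<open>bar x\<close> returns to
  its source: the reverse edge is there, and it is the only one with that label.\<close>

lemma path_cancel: "path E p (x # w) q \<Longrightarrow> path E p (cancel x w) q"
  by (cases w) (auto dest: edge_bar edge_unique)

lemma path_reduce: "path E p w q \<Longrightarrow> path E p (reduce w) q"
  unfolding reduce_def
proof (induction w arbitrary: p)
  case (Cons x w)
  then have "path E p (x # foldr cancel w []) q" by auto
  then show ?case by (simp only: foldr_Cons o_apply path_cancel)
qed simp

lemma path_subset_lists: "path E p w q \<Longrightarrow> E \<subseteq> UNIV \<times> B \<times> UNIV \<Longrightarrow> w \<in> lists B"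
  by (induction w arbitrary: p) auto

text \<open>Choose a path \<open>s p\<close> from \<open>b\<close> to each vertex \<open>p\<close>.
  An edge from \<open>p\<close> to \<open>q\<close> labeled \<open>x\<close> gives the generator
  \<open>s p @ [x] @ bar_word (s q)\<close>, and along a path the product of these generators
  telescopes.\<close>

lemma fin_gen_subgroup_loops:
  assumes fin: "finite E" and lab: "E \<subseteq> UNIV \<times> letters A \<times> UNIV"
    and conn: "\<And>p x q. (p, x, q) \<in> E \<Longrightarrow> \<exists>w. path E b w p"
  shows "fin_gen_subgroup A {w. reduced w \<and> path E b w b}"
proof -
  let ?G = "free_group A" and ?H = "{w. reduced w \<and> path E b w b}"
  interpret G: group ?G by (rule group_free_group)
  have car: "?H \<subseteq> carrier ?G"
    using path_subset_lists[OF _ lab] by (auto simp: carrier_free_group simp del: in_lists_conv_set)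
  have sub: "subgroup ?H ?G"
  proof (rule G.subgroupI)
    show "?H \<noteq> {}" by (auto intro: exI[of _ "[]"])
    fix u assume u: "u \<in> ?H"
    then show "inv\<^bsub>?G\<^esub> u \<in> ?H"
      using car by (auto simp: inv_free_group subset_iff reduced_bar_word path_bar_word)
    fix v assume "v \<in> ?H"
    then show "u \<otimes>\<^bsub>?G\<^esub> v \<in> ?H"
      using u by (auto simp: reduced_reduce path_append intro!: path_reduce)
  qed (rule car)
  \<comment> \<open>At \<open>b\<close> the chosen path is empty, so that the telescoped product
    along a loop at \<open>b\<close> is the label of the loop itself.\<close>
  define s where "s p = (if p = b then [] else SOME w. path E b w p)" for p
  have s: "path E b (s p) p" if "path E b w p" for w p
    using someI_ex[of "\<lambda>w. path E b w p"] that by (auto simp: s_def)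
  define g where "g = (\<lambda>(p, x, q). reduce (s p @ [x] @ bar_word (s q)))"
  have gen: "reduce (s p @ w @ bar_word (s q)) \<in> generate ?G (g ` E)" if "path E p w q" for p w q
    using that
  proof (induction w arbitrary: p)
    case Nil
    then show ?case using generate.one[of ?G] by simp
  next
    case (Cons x w)
    then obtain r where r: "(p, x, r) \<in> E" "path E r w q" by auto
    have "g (p, x, r) \<in> generate ?G (g ` E)" using r by (intro generate.incl) auto
    from generate.eng[OF this Cons.IH[OF r(2)]]
    have "reduce (s p @ [x] @ bar_word (s r) @ s r @ w @ bar_word (s q)) \<in> generate ?G (g ` E)"
      by (simp add: g_def)
    then show ?case
      using reduce_delete(2)[of "s p @ [x]" "s r" "w @ bar_word (s q)"] by simp
  qed
  have gH: "g ` E \<subseteq> ?H"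
  proof clarify
    fix p x q assume e: "(p, x, q) \<in> E"
    have "path E b (s p) p" "path E b (s q) q"
      using conn[OF e] conn[OF edge_bar[OF e]] s by blast+
    then have "path E b (s p @ [x] @ bar_word (s q)) b"
      using e path_bar_word[of b "s q" q] by (auto simp: path_append)
    then show "reduced (g (p, x, q)) \<and> path E b (g (p, x, q)) b"
      by (auto simp: g_def reduced_reduce intro!: path_reduce)
  qed
  have "?H = generate ?G (g ` E)"
  proof
    show "generate ?G (g ` E) \<subseteq> ?H"
      by (rule G.generate_subgroup_incl[OF gH sub])
    show "?H \<subseteq> generate ?G (g ` E)"
    proof clarify
      fix w assume "reduced w" "path E b w b"
      then show "w \<in> generate ?G (g ` E)" using gen[of b w b] by (simp add: s_def reduce_eq_self)
    qed
  qed
  moreover have "g ` E \<subseteq> carrier ?G" using gH car by blast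
  ultimately show ?thesis
    unfolding fin_gen_subgroup_def using sub fin by blast
qed

end

section \<open>Automata with inverse edges\<close>

definition closed_language :: "'a set \<Rightarrow> ('a + 'a) list set \<Rightarrow> bool" where
  "closed_language A L \<longleftrightarrow>
     (\<forall>u v. u @ v \<in> L \<longrightarrow> u \<in> L) \<and>
     (\<forall>u v. u \<in> L \<and> v \<in> L \<longrightarrow> u @ bar_word u @ v \<in> L) \<and>
     (\<forall>u v w. u @ v @ bar_word v @ w \<in> L \<longrightarrow> u @ w \<in> L) \<and>
     (\<forall>u. \<forall>a\<in>letters A. u @ [a] \<in> L \<longrightarrow>
        (\<exists>b\<in>letters A. b \<noteq> bar a \<and> u @ [a, b] \<in> L))"

lemma path_in_verts: "path E p w q \<Longrightarrow> p \<in> V \<Longrightarrow> E \<subseteq> UNIV \<times> UNIV \<times> V \<Longrightarrow> q \<in> V"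
  by (induction w arbitrary: p) auto

text \<open>The definition speaks of positive letters only, but as an equivalence; its converse
  direction covers the formal inverses.\<close>

lemma involutive_graph_i_automaton:
  assumes "i_automaton A M"
  shows "involutive_graph (transitions M)"
proof
  fix p x q assume e: "(p, x, q) \<in> transitions M"
  moreover have "x \<in> letters A" using e assms by (auto simp: i_automaton_def automaton_over_def)
  ultimately show "(q, bar x, p) \<in> transitions M"
    using assms by (cases x) (auto simp: i_automaton_def letters_def)
qed (use assms in \<open>auto simp: i_automaton_def automaton_over_def\<close>)

lemma accepted_language_all_accepting:
  assumes "automaton_over \<Sigma> M" "accepting M = states M"
  shows "accepted_language M = {w. \<exists>q. path (transitions M) (initial M) w q}"
  using assms path_in_verts[of "transitions M" "initial M" _ _ "states M"]
  by (fastforce simp: accepted_language_def language_from_def automaton_over_def)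

text \<open>Reading \<open>v @ bar_word v\<close> leads back to the state where it began, which
  gives insertion at the initial state and deletion anywhere. For the extension property, at least
  one of two distinct letters leaving a state differs from \<open>bar a\<close>.\<close>

lemma closed_language_i_automaton:
  assumes M: "i_automaton A M" and acc: "accepting M = states M"
    and two: "two_letters_everywhere M"
  shows "closed_language A (accepted_language M)" "\<not> accepted_language M \<subseteq> {[]}"
proof -
  interpret involutive_graph "transitions M" using M by (rule involutive_graph_i_automaton)
  have aut: "automaton_over (letters A) M" using M by (simp add: i_automaton_def)
  note L = accepted_language_all_accepting[OF aut acc]
  have "\<exists>b\<in>letters A. b \<noteq> bar a \<and> u @ [a, b] \<in> accepted_language M"
    if ua: "u @ [a] \<in> accepted_language M" for u a
  proof -
    obtain q where q: "path (transitions M) (initial M) (u @ [a]) q" using ua unfolding L by auto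
    then have "q \<in> states M"
      using path_in_verts[OF q, of "states M"] aut by (auto simp: automaton_over_def)
    then obtain b r where "b \<noteq> bar a" "(q, b, r) \<in> transitions M"
      using two unfolding two_letters_everywhere_def by metis
    moreover from this have "b \<in> letters A" using aut by (auto simp: automaton_over_def)
    moreover have "path (transitions M) (initial M) ((u @ [a]) @ [b]) r"
      using q \<open>(q, b, r) \<in> _\<close> unfolding path_append by auto
    ultimately show ?thesis using L by auto
  qed
  moreover have "u @ w \<in> accepted_language M"
    if vw: "u @ v @ bar_word v @ w \<in> accepted_language M" for u v w
  proof -
    obtain p q p' r where "path (transitions M) (initial M) u p" "path (transitions M) p v q"
      "path (transitions M) q (bar_word v) p'" "path (transitions M) p' w r"
      using vw unfolding L by (auto simp: path_append)
    moreover from this have "p' = p" using path_bar_word path_unique by blast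
    ultimately have "path (transitions M) (initial M) (u @ w) r" unfolding path_append by blast
    then show ?thesis unfolding L by blast
  qed
  moreover have "u \<in> accepted_language M" if "u @ v \<in> accepted_language M" for u v
    using that unfolding L by (auto simp: path_append)
  moreover have "u @ bar_word u @ v \<in> accepted_language M"
    if "u \<in> accepted_language M" "v \<in> accepted_language M" for u v
    using that path_bar_word unfolding L by (fastforce simp: path_append)
  ultimately show "closed_language A (accepted_language M)"
    unfolding closed_language_def by blast
  show "\<not> accepted_language M \<subseteq> {[]}"
    by (rule two_letters_everywhere_imp_nontrivial[OF aut acc two])
qed

text \<open>A path of the quotient need not lift to a path from a given representative, since
  consecutive edges may come from different representatives of the same class. But equivalent states
  have the same language, so the representative can be exchanged before each letter.\<close>

lemma accepted_language_merge_states: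
  assumes aut: "automaton_over \<Sigma> M"
  shows "accepted_language (merge_states M) = accepted_language M"
proof -
  let ?c = "\<lambda>p. state_equiv M `` {p}"
  let ?E = "transitions (merge_states M)"
  have T: "transitions M \<subseteq> states M \<times> \<Sigma> \<times> states M" and acc: "accepting M \<subseteq> states M"
    using aut by (auto simp: automaton_over_def)
  have lift: "path ?E (?c p) w (?c q)" if "path (transitions M) p w q" for p w q
    using that by (induction w arbitrary: p) (auto simp: merge_states_def)
  \<comment> \<open>It is enough that \<open>q\<close> is a state: the class of a non-state is
    empty, hence different from that of \<open>q\<close>.\<close>
  have eq: "language_from M p = language_from M q" if "?c p = ?c q" "q \<in> states M" for p q
  proof -
    have "q \<in> ?c q" using that(2) by (simp add: state_equiv_def)
    then have "(p, q) \<in> state_equiv M" using that(1) by auto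
    then show ?thesis by (simp add: state_equiv_def)
  qed
  have "w \<in> language_from M p" if pQ: "path ?E (?c p) w Q" and Q: "Q \<in> accepting M // state_equiv M" for p w Q
    using pQ
  proof (induction w arbitrary: p)
    case Nil
    then obtain f where f: "f \<in> accepting M" "?c p = ?c f" using Q by (auto elim: quotientE)
    moreover have "[] \<in> language_from M f" using f by (simp add: language_from_def)
    ultimately show ?case using eq acc by blast
  next
    case (Cons x w)
    then obtain p' q' where e: "?c p = ?c p'" "(p', x, q') \<in> transitions M" "path ?E (?c q') w Q"
      by (auto simp: merge_states_def)
    have "x # w \<in> language_from M p'" using Cons.IH[OF e(3)] e(2) by (auto simp: language_from_def)
    then show ?case using eq[OF e(1)] e(2) T by blast
  qed
  then have "language_from (merge_states M) (?c (initial M)) \<subseteq> language_from M (initial M)"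
    by (auto simp: language_from_def[of "merge_states M"]) (simp add: merge_states_def)
  moreover have "language_from M (initial M) \<subseteq> language_from (merge_states M) (?c (initial M))"
  proof
    fix w assume "w \<in> language_from M (initial M)"
    then obtain q where "q \<in> accepting M" "path (transitions M) (initial M) w q"
      by (auto simp: language_from_def)
    then show "w \<in> language_from (merge_states M) (?c (initial M))"
      using lift[of "initial M" w q]
      by (auto simp: language_from_def merge_states_def intro!: bexI[of _ "?c q"] quotientI)
  qed
  moreover have "initial (merge_states M) = ?c (initial M)" by (simp add: merge_states_def)
  ultimately show ?thesis by (simp add: accepted_language_def)
qed

text \<open>If distinct states have distinct languages, all classes are singletons, and merging
  yields a copy of the automaton along the map from \<open>p\<close> to \<open>{p}\<close>.\<close>

lemma i_automaton_merge_states: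
  assumes M: "i_automaton A M"
    and acc: "accepting M = states M" and two: "two_letters_everywhere M"
    and inj: "\<And>p q. p \<in> states M \<Longrightarrow> q \<in> states M \<Longrightarrow> language_from M p = language_from M q \<Longrightarrow> p = q"
  shows "i_automaton A (merge_states M)" "accepting (merge_states M) = states (merge_states M)"
    "two_letters_everywhere (merge_states M)"
proof -
  have aut: "automaton_over (letters A) M" using M by (simp add: i_automaton_def)
  then have T: "transitions M \<subseteq> states M \<times> letters A \<times> states M" "initial M \<in> states M"
    by (auto simp: automaton_over_def)
  have eq: "state_equiv M = Id_on (states M)" using inj by (auto simp: state_equiv_def)
  have sing: "state_equiv M `` {p} = {p}" if "p \<in> states M" for p using that eq by auto
  have st: "states (merge_states M) = (\<lambda>p. {p}) ` states M"
    using sing by (auto simp: merge_states_def quotient_def)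
  have tr: "transitions (merge_states M) = {({p}, x, {q}) | p x q. (p, x, q) \<in> transitions M}"
  proof -
    have "transitions (merge_states M) =
      (\<lambda>(p, x, q). (state_equiv M `` {p}, x, state_equiv M `` {q})) ` transitions M"
      by (force simp: merge_states_def)
    also have "\<dots> = (\<lambda>(p, x, q). ({p}, x, {q})) ` transitions M"
      using T sing by (intro image_cong) auto
    also have "\<dots> = {({p}, x, {q}) | p x q. (p, x, q) \<in> transitions M}"
      by force
    finally show ?thesis .
  qed
  show acc': "accepting (merge_states M) = states (merge_states M)" using acc by (simp add: merge_states_def)
  show "i_automaton A (merge_states M)"
    using M T sing[of "initial M"] acc'
    by (auto simp: i_automaton_def automaton_over_def st tr) (auto simp: merge_states_def)
  show "two_letters_everywhere (merge_states M)"
    unfolding two_letters_everywhere_def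
  proof
    fix P assume "P \<in> states (merge_states M)"
    then obtain p where p: "p \<in> states M" "P = {p}" using st by auto
    then obtain a b q r where "a \<noteq> b" "(p, a, q) \<in> transitions M" "(p, b, r) \<in> transitions M"
      using two unfolding two_letters_everywhere_def by metis
    with p show "\<exists>a b Q R. a \<noteq> b \<and> (P, a, Q) \<in> transitions (merge_states M) \<and> (P, b, R) \<in> transitions (merge_states M)"
      unfolding tr by blast
  qed
qed

section \<open>Core and tail of a folded graph\<close>

lemma two_way_simps [simp]:
  "(p, Inl a, q) \<in> two_way E \<longleftrightarrow> (p, a, q) \<in> E"
  "(p, Inr a, q) \<in> two_way E \<longleftrightarrow> (q, a, p) \<in> E"
  by (auto simp: two_way_def)

lemma two_way_bar: "(p, bar x, q) \<in> two_way E \<longleftrightarrow> (q, x, p) \<in> two_way E"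
  by (cases x) auto

lemma two_way_subset: "E \<subseteq> V \<times> A \<times> V \<Longrightarrow> two_way E \<subseteq> V \<times> letters A \<times> V"
  by (auto simp: two_way_def letters_def)

text \<open>An incoming edge is counted as an outgoing one with a letter \<open>Inr a\<close>. A
  loop appears once as \<open>Inl a\<close> and once as \<open>Inr a\<close>, in accordance with its
  contribution 2.\<close>

lemma degree_eq_card_out:
  assumes "finite (edges \<Gamma>)"
  shows "degree \<Gamma> v = card {(x, q). (v, x, q) \<in> two_way (edges \<Gamma>)}"
proof -
  let ?I = "{(p, a, q) \<in> edges \<Gamma>. q = v}" and ?O = "{(p, a, q) \<in> edges \<Gamma>. p = v}"
  let ?f = "\<lambda>(p, a, q). (Inr a :: 'b + 'b, p)" and ?g = "\<lambda>(p, a, q). (Inl a :: 'b + 'b, q)"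
  have fin: "finite ?I" "finite ?O" using assms by (auto intro: finite_subset[rotated])
  have eq: "{(x, q). (v, x, q) \<in> two_way (edges \<Gamma>)} = ?f ` ?I \<union> ?g ` ?O"
    by (auto simp: two_way_def image_iff split: prod.splits)
  have "card (?f ` ?I) = card ?I" "card (?g ` ?O) = card ?O"
    by (auto intro!: card_image simp: inj_on_def)
  moreover have "?f ` ?I \<inter> ?g ` ?O = {}" by auto
  ultimately show ?thesis
    unfolding eq degree_def using fin by (subst card_Un_disjoint) auto
qed

text \<open>The local part of the definition of a Stallings graph, without the group, connectedness
  and degrees. It serves both for a given Stallings graph and for the graph constructed from a
  language.\<close>

locale folded_graph =
  fixes \<Gamma> :: "('v, 'a) pointed_graph" and A :: "'a set"
  assumes finite_verts: "finite (verts \<Gamma>)" and finite_letters: "finite A"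
    and edges_subset: "edges \<Gamma> \<subseteq> verts \<Gamma> \<times> A \<times> verts \<Gamma>"
    and out_unique: "(p, a, q) \<in> edges \<Gamma> \<Longrightarrow> (p, a, q') \<in> edges \<Gamma> \<Longrightarrow> q = q'"
    and in_unique: "(p, a, q) \<in> edges \<Gamma> \<Longrightarrow> (p', a, q) \<in> edges \<Gamma> \<Longrightarrow> p = p'"
    and base_in_verts: "base \<Gamma> \<in> verts \<Gamma>"
begin

abbreviation "E \<equiv> two_way (edges \<Gamma>)"

sublocale involutive_graph E
proof
  show "q = q'" if "(p, x, q) \<in> E" "(p, x, q') \<in> E" for p x q q'
    using that by (cases x) (auto dest: out_unique in_unique)
qed (simp add: two_way_bar)

lemma finite_edges: "finite (edges \<Gamma>)"
  using finite_subset[OF edges_subset] finite_verts finite_letters by simp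

lemma E_subset: "E \<subseteq> verts \<Gamma> \<times> letters A \<times> verts \<Gamma>"
  using edges_subset by (rule two_way_subset)

lemma degree_eq_card_letters: "degree \<Gamma> v = card {x. \<exists>q. (v, x, q) \<in> E}"
proof -
  have "{x. \<exists>q. (v, x, q) \<in> E} = fst ` {(x, q). (v, x, q) \<in> E}" by force
  moreover have "inj_on fst {(x, q). (v, x, q) \<in> E}"
    by (auto simp: inj_on_def dest: edge_unique)
  ultimately show ?thesis by (simp add: degree_eq_card_out[OF finite_edges] card_image)
qed

lemma finite_out_letters: "finite {x. \<exists>q. (v, x, q) \<in> E}"
  by (rule finite_subset[of _ "letters A"]) (use E_subset finite_letters in \<open>auto simp: letters_def\<close>)

lemma degree_ge: "X \<subseteq> {x. \<exists>q. (v, x, q) \<in> E} \<Longrightarrow> card X \<le> degree \<Gamma> v"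
  unfolding degree_eq_card_letters by (rule card_mono[OF finite_out_letters])

lemma degree_gt_obtain:
  assumes "card X < degree \<Gamma> v" "finite X"
  obtains x q where "x \<notin> X" "(v, x, q) \<in> E"
proof -
  have "\<not> {x. \<exists>q. (v, x, q) \<in> E} \<subseteq> X"
  proof
    assume "{x. \<exists>q. (v, x, q) \<in> E} \<subseteq> X"
    from card_mono[OF assms(2) this] show False
      using assms(1) degree_eq_card_letters[of v] by linarith
  qed
  then show thesis using that by blast
qed

lemma degree_ge_2_obtain:
  assumes "degree \<Gamma> v \<ge> 2"
  obtains x y q r where "x \<noteq> y" "(v, x, q) \<in> E" "(v, y, r) \<in> E"
proof -
  have "card {} < degree \<Gamma> v" using assms by simp
  then obtain x q where x: "(v, x, q) \<in> E" by (rule degree_gt_obtain) simp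
  have "card {x} < degree \<Gamma> v" using assms by simp
  then obtain y r where "y \<notin> {x}" "(v, y, r) \<in> E" by (rule degree_gt_obtain) simp
  with x show thesis by (intro that[of x y q r]) auto
qed

lemma core_verts_subset: "core_verts \<Gamma> \<subseteq> verts \<Gamma>"
  by (auto simp: core_verts_def)

lemma two_way_core_edges: "two_way (core_edges \<Gamma>) = E \<inter> (core_verts \<Gamma> \<times> UNIV \<times> core_verts \<Gamma>)"
  by (auto simp: two_way_def core_edges_def)

lemma tail_verts_subset: "tail_verts \<Gamma> \<subseteq> verts \<Gamma>"
proof
  fix v assume "v \<in> tail_verts \<Gamma>"
  then show "v \<in> verts \<Gamma>" by induction (use base_in_verts E_subset in auto)
qed

text \<open>
  The tail is built from the base by adding vertices of degree 2 one by one. At each stage at most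
  one edge leaves the part built so far, and the next vertex has to be the target of that edge.
\<close>

lemma tail_boundary_unique:
  assumes deg: "degree \<Gamma> (base \<Gamma>) \<le> 1"
    and e: "(p, x, q) \<in> E" "p \<in> tail_verts \<Gamma>" "q \<notin> tail_verts \<Gamma>"
    and e': "(p', x', q') \<in> E" "p' \<in> tail_verts \<Gamma>" "q' \<notin> tail_verts \<Gamma>"
  shows "(p, x, q) = (p', x', q')"
proof -
  \<comment> \<open>The possible stages of the construction: parts of the tail that contain the base
    and are left by at most one edge. A largest such part turns out to be closed under the rule
    \<open>step\<close>, so it is the whole tail.\<close>
  define ok where "ok T \<longleftrightarrow> base \<Gamma> \<in> T \<and> T \<subseteq> tail_verts \<Gamma> \<and>
    (\<forall>p x q p' x' q'. (p, x, q) \<in> E \<and> p \<in> T \<and> q \<notin> T \<and> (p', x', q') \<in> E \<and> p' \<in> T \<and> q' \<notin> T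
      \<longrightarrow> (p, x, q) = (p', x', q'))" for T
  have "ok {base \<Gamma>}"
    unfolding ok_def
  proof (intro conjI allI impI)
    fix p x q p' x' q'
    assume a: "(p, x, q) \<in> E \<and> p \<in> {base \<Gamma>} \<and> q \<notin> {base \<Gamma>} \<and>
      (p', x', q') \<in> E \<and> p' \<in> {base \<Gamma>} \<and> q' \<notin> {base \<Gamma>}"
    then have "card {x, x'} \<le> degree \<Gamma> (base \<Gamma>)" by (intro degree_ge) auto
    then have "card {x, x'} \<le> 1" using deg by linarith
    then have "x = x'" by (cases "x = x'") auto
    then show "(p, x, q) = (p', x', q')" using a by (auto dest: edge_unique)
  qed (auto intro: tail_verts.base)
  moreover have fin: "finite (tail_verts \<Gamma>)"
    using tail_verts_subset finite_verts by (rule finite_subset)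
  ultimately have "\<exists>T. ok T \<and> (\<forall>T'. ok T' \<longrightarrow> card T' \<le> card T)"
    by (intro ex_has_greatest_nat[of ok "{base \<Gamma>}" card "Suc (card (tail_verts \<Gamma>))"])
      (auto simp: ok_def less_Suc_eq_le intro: card_mono)
  then obtain T where T: "ok T" and max: "\<And>T'. ok T' \<Longrightarrow> card T' \<le> card T"
    by blast
  have Tsub: "T \<subseteq> tail_verts \<Gamma>" and Tb: "base \<Gamma> \<in> T" and
    Tu: "\<And>p x q p' x' q'. (p, x, q) \<in> E \<Longrightarrow> p \<in> T \<Longrightarrow> q \<notin> T \<Longrightarrow> (p', x', q') \<in> E \<Longrightarrow> p' \<in> T \<Longrightarrow> q' \<notin> T
      \<Longrightarrow> p = p' \<and> x = x' \<and> q = q'"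
    using T unfolding ok_def by blast+
  have closed: "q \<in> T" if "p \<in> T" "(p, x, q) \<in> E" "degree \<Gamma> q = 2" for p x q
  proof (rule ccontr)
    assume q: "q \<notin> T"
    \<comment> \<open>The only edge leaving \<open>T\<close> goes to \<open>q\<close>, so an edge
      leaving \<open>insert q T\<close> starts at \<open>q\<close>.\<close>
    have 1: False if "(p', x', q') \<in> E" "p' \<in> T" "q' \<notin> insert q T" for p' x' q'
      using Tu[OF \<open>(p, x, q) \<in> E\<close> \<open>p \<in> T\<close> q that(1,2)] that(3) by auto
    \<comment> \<open>One of the two edges at \<open>q\<close> goes back to \<open>p\<close>, so
      only one is left to lead elsewhere.\<close>
    have 2: "x1 = x2" if "(q, x1, q1) \<in> E" "q1 \<notin> insert q T" "(q, x2, q2) \<in> E" "q2 \<notin> insert q T"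
      for x1 q1 x2 q2
    proof (rule ccontr)
      assume "x1 \<noteq> x2"
      have r: "(q, bar x, p) \<in> E" using that edge_bar \<open>(p, x, q) \<in> E\<close> by blast
      then have "bar x \<noteq> x1" "bar x \<noteq> x2" using that edge_unique \<open>p \<in> T\<close> by blast+
      moreover have "card {bar x, x1, x2} \<le> 2"
        using that r degree_ge[of "{bar x, x1, x2}" q] \<open>degree \<Gamma> q = 2\<close> by auto
      ultimately show False using \<open>x1 \<noteq> x2\<close> by simp
    qed
    have "ok (insert q T)"
      unfolding ok_def
    proof (intro conjI allI impI)
      show "base \<Gamma> \<in> insert q T" using Tb by simp
      have "q \<in> tail_verts \<Gamma>" using that(1) Tsub tail_verts.step[OF _ that(2,3)] by blast
      then show "insert q T \<subseteq> tail_verts \<Gamma>" using Tsub by simp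
      fix p1 x1 q1 p2 x2 q2
      assume a: "(p1, x1, q1) \<in> E \<and> p1 \<in> insert q T \<and> q1 \<notin> insert q T \<and>
        (p2, x2, q2) \<in> E \<and> p2 \<in> insert q T \<and> q2 \<notin> insert q T"
      have p: "p1 = q" "p2 = q" using 1[of p1 x1 q1] 1[of p2 x2 q2] a by auto
      then have "x1 = x2" using a 2[of x1 q1 x2 q2] by simp
      then show "(p1, x1, q1) = (p2, x2, q2)" using a p by (auto dest: edge_unique)
    qed
    from max[OF this] show False using q finite_subset[OF Tsub fin] by simp
  qed
  have "tail_verts \<Gamma> \<subseteq> T"
  proof
    fix v assume "v \<in> tail_verts \<Gamma>"
    then show "v \<in> T" by induction (use Tb closed in auto)
  qed
  then have "T = tail_verts \<Gamma>" using Tsub by blast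
  then show ?thesis using Tu e e' by blast
qed

text \<open>Removing the tail costs a core vertex at most one edge, since only one edge joins the
  tail to the rest. A vertex that loses an edge has degree at least 3, for with degree 2 it would
  belong to the tail.\<close>

lemma core_two_letters:
  assumes deg: "\<And>v. v \<in> verts \<Gamma> - {base \<Gamma>} \<Longrightarrow> degree \<Gamma> v \<ge> 2" and v: "v \<in> core_verts \<Gamma>"
  shows "\<exists>x y q r. x \<noteq> y \<and> (v, x, q) \<in> two_way (core_edges \<Gamma>) \<and> (v, y, r) \<in> two_way (core_edges \<Gamma>)"
proof (cases "cyclically_reduced \<Gamma>")
  case True
  then have "degree \<Gamma> v \<ge> 2" using v by (auto simp: core_verts_def cyclically_reduced_def)
  then obtain x y q r where "x \<noteq> y" "(v, x, q) \<in> E" "(v, y, r) \<in> E" by (rule degree_ge_2_obtain)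
  moreover from this have "v \<in> verts \<Gamma>" "q \<in> verts \<Gamma>" "r \<in> verts \<Gamma>" using E_subset by auto
  ultimately show ?thesis using True unfolding two_way_core_edges core_verts_def by auto
next
  case False
  then have base: "degree \<Gamma> (base \<Gamma>) \<le> 1"
    using deg unfolding cyclically_reduced_def by force
  have core: "core_verts \<Gamma> = verts \<Gamma> - tail_verts \<Gamma>" using False by (simp add: core_verts_def)
  have ext: "(v, x, q) \<in> two_way (core_edges \<Gamma>)" if "(v, x, q) \<in> E" "q \<notin> tail_verts \<Gamma>" for x q
    using that v core E_subset by (auto simp: two_way_core_edges)
  have uniq: "x = y" if "(v, x, q) \<in> E" "q \<in> tail_verts \<Gamma>" "(v, y, r) \<in> E" "r \<in> tail_verts \<Gamma>" for x q y r
    using tail_boundary_unique[OF base edge_bar[OF that(1)] that(2) _ edge_bar[OF that(3)] that(4)] v core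
    by (auto dest: arg_cong[of _ _ bar])
  have "degree \<Gamma> v \<ge> 2" using v core deg tail_verts.base by blast
  then obtain x y q r where xy: "x \<noteq> y" "(v, x, q) \<in> E" "(v, y, r) \<in> E" by (rule degree_ge_2_obtain)
  show ?thesis
  proof (cases "q \<in> tail_verts \<Gamma> \<or> r \<in> tail_verts \<Gamma>")
    case True
    then have "degree \<Gamma> v \<noteq> 2"
      using tail_verts.step[OF _ edge_bar[OF xy(2)]] tail_verts.step[OF _ edge_bar[OF xy(3)]] v core
      by blast
    then have "card {x, y} < degree \<Gamma> v" using \<open>degree \<Gamma> v \<ge> 2\<close> xy(1) by simp
    then obtain z s where z: "z \<noteq> x" "z \<noteq> y" "(v, z, s) \<in> E" by (rule degree_gt_obtain) auto
    have "s \<notin> tail_verts \<Gamma>"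
      using True uniq[OF z(3) _ xy(2)] uniq[OF z(3) _ xy(3)] z(1,2) by blast
    then have zs: "(v, z, s) \<in> two_way (core_edges \<Gamma>)" using ext z(3) by simp
    have "q \<notin> tail_verts \<Gamma> \<or> r \<notin> tail_verts \<Gamma>" using uniq[OF xy(2) _ xy(3)] xy(1) by blast
    then have "\<exists>y r. y \<noteq> z \<and> (v, y, r) \<in> two_way (core_edges \<Gamma>)"
      using ext[OF xy(2)] ext[OF xy(3)] z(1,2) by metis
    with zs show ?thesis by blast
  qed (use xy ext in blast)
qed

end

lemma folded_graph_stallings:
  "finite A \<Longrightarrow> stallings_graph A H \<Gamma> \<Longrightarrow> folded_graph \<Gamma> A"
  unfolding stallings_graph_def by unfold_locales blast+

text \<open>The automaton is the core with initial state \<open>p\<close>. As \<open>t\<close> is a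
  shortest path into the core, the vertex before its end lies outside, and by determinism the edge
  labeled \<open>bar a\<close> at \<open>p\<close> leads to that vertex.\<close>

lemma i_automaton_of_core:
  fixes \<Gamma> :: "('v, 'a) pointed_graph"
  assumes A: "finite A" and \<Gamma>: "stallings_graph A H \<Gamma>" and t: "tail_word \<Gamma> t p"
  shows "\<exists>M :: ('v, 'a + 'a) automaton. i_automaton A M \<and> accepted_language M = core_language \<Gamma> p \<and>
           accepting M = states M \<and> two_letters_everywhere M"
    and "tail_compatible A t (core_language \<Gamma> p)"
proof -
  interpret folded_graph \<Gamma> A using A \<Gamma> by (rule folded_graph_stallings)
  define M where "M = \<lparr>states = core_verts \<Gamma>, initial = p,
    transitions = two_way (core_edges \<Gamma>), accepting = core_verts \<Gamma>\<rparr>"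
  have p: "p \<in> core_verts \<Gamma>"
    using t base_in_verts by (auto simp: tail_word_def core_verts_def split: if_splits)
  have "automaton_over (letters A) M"
    using p E_subset finite_subset[OF core_verts_subset finite_verts]
    unfolding automaton_over_def by (auto simp: M_def two_way_core_edges dest: edge_unique)
  moreover from this have "accepted_language M = core_language \<Gamma> p"
    by (subst accepted_language_all_accepting) (auto simp: M_def core_language_def)
  moreover from calculation have "i_automaton A M"
    by (auto simp: i_automaton_def M_def)
  moreover have "two_letters_everywhere M"
    using core_two_letters \<Gamma> by (auto simp: two_letters_everywhere_def M_def stallings_graph_def)
  ultimately show "\<exists>M :: ('v, 'a + 'a) automaton. i_automaton A M \<and>
      accepted_language M = core_language \<Gamma> p \<and> accepting M = states M \<and> two_letters_everywhere M"
    by (intro exI[of _ M]) (auto simp: M_def)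
  show "tail_compatible A t (core_language \<Gamma> p)"
    unfolding tail_compatible_def
  proof
    assume "t \<noteq> []"
    then obtain t' a where ta: "t = t' @ [a]" by (metis append_butlast_last_id)
    then have path: "path E (base \<Gamma>) (t' @ [a]) p"
      and min: "\<And>s q. q \<in> core_verts \<Gamma> \<Longrightarrow> path E (base \<Gamma>) s q \<Longrightarrow> length t \<le> length s"
      using t by (auto simp: tail_word_def split: if_splits)
    then obtain r where r: "path E (base \<Gamma>) t' r" "(r, a, p) \<in> E" by (auto simp: path_append)
    then have "r \<notin> core_verts \<Gamma>" using min ta by fastforce
    then have "[bar a] \<notin> core_language \<Gamma> p"
      using r(2) by (auto simp: core_language_def two_way_core_edges two_way_bar dest: edge_bar edge_unique)
    moreover have "a \<in> letters A" using r(2) E_subset by auto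
    ultimately show "\<exists>t'. \<exists>a\<in>letters A. t = t' @ [a] \<and> [bar a] \<notin> core_language \<Gamma> p"
      using ta by blast
  qed
qed

section \<open>The automaton of left quotients\<close>

lemma path_deterministic:
  assumes "\<And>p x q q'. (p, x, q) \<in> E \<Longrightarrow> (p, x, q') \<in> E \<Longrightarrow> q = q'"
  shows "path E p w q \<Longrightarrow> path E p w q' \<Longrightarrow> q = q'"
  by (induction w arbitrary: p) (auto dest: assms)

text \<open>The transition graph of a minimal automaton with all states accepting; the last
  assumption expresses that no two states can be merged. The states are an initial segment of the
  natural numbers, which leaves the numbers from \<open>n\<close> on for the vertices of a
  tail.\<close>

locale core_automaton = involutive_graph E for E :: "(nat \<times> ('a + 'a) \<times> nat) set" +
  fixes A :: "'a set" and n i :: nat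
  assumes finite_letters: "finite A" and E_subset: "E \<subseteq> {..<n} \<times> letters A \<times> {..<n}"
    and initial: "i < n"
    and two_letters: "p < n \<Longrightarrow> \<exists>x y q r. x \<noteq> y \<and> (p, x, q) \<in> E \<and> (p, y, r) \<in> E"
    and reachable: "p < n \<Longrightarrow> \<exists>w. path E i w p"
    and distinct_languages:
      "p < n \<Longrightarrow> q < n \<Longrightarrow> {w. \<exists>r. path E p w r} = {w. \<exists>r. path E q w r} \<Longrightarrow> p = q"

text \<open>The easy half of the Myhill-Nerode theorem: the quotient by \<open>u\<close> is the
  language accepted from the state that \<open>u\<close> leads to.\<close>

lemma finite_left_quotients:
  assumes "rational_language \<Sigma> L"
  shows "finite {{v. u @ v \<in> L} | u. u \<in> L}"
proof -
  obtain M :: "(nat, 'a) automaton" where M: "automaton_over \<Sigma> M" "accepted_language M = L"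
    using assms by (auto simp: rational_language_def)
  have "{v. u @ v \<in> L} \<in> language_from M ` states M" if u: "u \<in> L" for u
  proof -
    obtain q where q: "path (transitions M) (initial M) u q"
      using u M(2) by (auto simp: accepted_language_def language_from_def)
    have "q \<in> states M"
      using path_in_verts[OF q, of "states M"] M(1) by (auto simp: automaton_over_def)
    have uniq: "q' = q" if "path (transitions M) (initial M) u q'" for q'
    proof (rule path_deterministic[OF _ that q])
      show "s = s'" if "(p, x, s) \<in> transitions M" "(p, x, s') \<in> transitions M" for p x s s'
        using M(1) that unfolding automaton_over_def by blast
    qed
    have "path (transitions M) (initial M) (u @ v) r \<longleftrightarrow> path (transitions M) q v r" for v r
      using q by (metis path_append uniq)
    then have "{v. u @ v \<in> L} = language_from M q"
      unfolding M(2)[symmetric] accepted_language_def language_from_def by simp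
    with \<open>q \<in> states M\<close> show ?thesis by blast
  qed
  then have "{{v. u @ v \<in> L} | u. u \<in> L} \<subseteq> language_from M ` states M" by blast
  moreover have "finite (language_from M ` states M)" using M(1) by (simp add: automaton_over_def)
  ultimately show ?thesis by (rule finite_subset)
qed

text \<open>The states are the left quotients of the language, numbered by \<open>g\<close>.\<close>

lemma core_automaton_of_closed_language:
  assumes A: "finite A" and L: "L \<subseteq> lists (letters A)" and rat: "rational_language (letters A) L"
    and closed: "closed_language A L" and nontrivial: "\<not> L \<subseteq> {[]}"
  obtains E n i where "core_automaton E A n i" "L = {w. \<exists>q. path E i w q}"
proof -
  have prefix: "u \<in> L" if "u @ v \<in> L" for u v
    using closed that unfolding closed_language_def by blast
  have insert: "u @ bar_word u @ v \<in> L" if "u \<in> L" "v \<in> L" for u v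
    using closed that unfolding closed_language_def by blast
  have delete: "u @ w \<in> L" if "u @ v @ bar_word v @ w \<in> L" for u v w
    using closed that unfolding closed_language_def by blast
  have extend: "\<exists>b. b \<noteq> bar a \<and> u @ [a, b] \<in> L" if "u @ [a] \<in> L" for u a
  proof -
    have "a \<in> letters A" using subsetD[OF L that] by simp
    then show ?thesis using closed that unfolding closed_language_def by blast
  qed
  obtain a0 w0 where "a0 # w0 \<in> L" using nontrivial by (metis neq_Nil_conv singletonI subsetI)
  then have a0: "[a0] \<in> L" using prefix[of "[a0]" w0] by simp
  then have Nil: "[] \<in> L" using prefix[of "[]" "[a0]"] by simp
  define Q where "Q = {{v. u @ v \<in> L} | u. u \<in> L}"
  define n where "n = card Q"
  have "finite Q" unfolding Q_def using rat by (rule finite_left_quotients)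
  then obtain g where g: "bij_betw g {..<n} Q"
    using ex_bij_betw_nat_finite[of Q] by (auto simp: n_def atLeast0LessThan)
  define E where "E = {(m, x, k). m < n \<and> k < n \<and> [x] \<in> g m \<and> g k = {v. x # v \<in> g m}}"
  have gQ: "\<exists>u. u \<in> L \<and> g m = {v. u @ v \<in> L}" if "m < n" for m
    using bij_betwE[OF g] that by (auto simp: Q_def)
  have gex: "\<exists>m<n. g m = {v. u @ v \<in> L}" if "u \<in> L" for u
  proof -
    have "{v. u @ v \<in> L} \<in> g ` {..<n}" using g that by (auto simp: bij_betw_def Q_def)
    then show ?thesis by auto
  qed
  have ginj: "m = k" if "g m = g k" "m < n" "k < n" for m k
    using g that by (auto simp: bij_betw_def inj_on_def)
  have path: "w \<in> g m \<and> g k = {v. w @ v \<in> g m}" if "path E m w k" "m < n" for m w k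
    using that
  proof (induction w arbitrary: m)
    case Nil
    then obtain u where "u \<in> L" "g m = {v. u @ v \<in> L}" using gQ by blast
    then have "[] \<in> g m" by simp
    then show ?case using Nil by simp
  next
    case (Cons x w)
    then obtain r where r: "(m, x, r) \<in> E" "path E r w k" by auto
    then have "r < n" "g r = {v. x # v \<in> g m}" by (auto simp: E_def)
    then show ?case using Cons.IH[OF r(2)] by simp
  qed
  have path_ex: "\<exists>k. path E m w k" if "w \<in> g m" "m < n" for m w
    using that
  proof (induction w arbitrary: m)
    case (Cons x w)
    then obtain u where u: "u \<in> L" "g m = {v. u @ v \<in> L}" using gQ by blast
    then have ux: "u @ [x] \<in> L" using Cons.prems(1) prefix[of "u @ [x]" w] by simp
    then obtain k where k: "k < n" "g k = {v. (u @ [x]) @ v \<in> L}" using gex by blast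
    then have "(m, x, k) \<in> E" "w \<in> g k" using u ux Cons.prems by (auto simp: E_def)
    then show ?case using Cons.IH k(1) by fastforce
  qed (auto intro: exI[of _ m])
  \<comment> \<open>A state, being a quotient, is the language read from it. Hence distinct states
    have distinct languages.\<close>
  have lang: "{w. \<exists>k. path E m w k} = g m" if "m < n" for m
    using path path_ex that by blast
  obtain i where i: "i < n" "g i = L" using gex[OF Nil] by auto
  have "core_automaton E A n i"
  proof
    show "finite A" by (rule A)
    have "x \<in> letters A" if "(m, x, k) \<in> E" for m x k
    proof -
      have m: "m < n" "[x] \<in> g m" using that by (auto simp: E_def)
      then obtain u where "g m = {v. u @ v \<in> L}" using gQ by blast
      with m(2) have "u @ [x] \<in> L" by simp
      then have "u @ [x] \<in> lists (letters A)" using L by blast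
      then show ?thesis by simp
    qed
    then show "E \<subseteq> {..<n} \<times> letters A \<times> {..<n}" unfolding E_def by blast
    show "i < n" by (rule i)
    show "p = q" if "p < n" "q < n" "{w. \<exists>r. path E p w r} = {w. \<exists>r. path E q w r}" for p q
      using that ginj[of p q] lang[of p] lang[of q] by blast
    show "q = q'" if "(p, x, q) \<in> E" "(p, x, q') \<in> E" for p x q q'
      using that ginj by (auto simp: E_def)
    show "\<exists>w. path E i w p" if p: "p < n" for p
    proof -
      obtain u where u: "u \<in> L" "g p = {v. u @ v \<in> L}" using gQ p by blast
      then obtain k where k: "path E i u k" using path_ex i by blast
      then have "k < n" using path_in_verts[OF k, of "{..<n}"] i by (auto simp: E_def)
      moreover have "g k = g p" using path[OF k i(1)] i(2) u(2) by simp
      ultimately show ?thesis using k ginj p by blast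
    qed
    show "(q, bar x, p) \<in> E" if e: "(p, x, q) \<in> E" for p x q
    proof -
      have p: "p < n" "q < n" "g q = {v. x # v \<in> g p}" and x: "[x] \<in> g p" using e by (auto simp: E_def)
      obtain u where u: "u \<in> L" "g p = {v. u @ v \<in> L}" using gQ p by blast
      have ux: "u @ [x] \<in> L" using x u by simp
      \<comment> \<open>Passing through \<open>x\<close> and back does not change a quotient.
        Insertion yields \<open>u @ [x]\<close>, its inverse and then \<open>u @ v\<close>; deleting
        \<open>bar_word u @ u\<close> leaves the word wanted.\<close>
      have eq: "v \<in> g p \<longleftrightarrow> bar x # v \<in> g q" for v
      proof
        assume "v \<in> g p"
        then have "u @ x # bar x # bar_word u @ u @ v \<in> L"
          using insert[OF ux, of "u @ v"] u by simp
        then show "bar x # v \<in> g q"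
          using delete[of "u @ [x, bar x]" "bar_word u" v] u p by simp
      next
        assume "bar x # v \<in> g q"
        then show "v \<in> g p" using delete[of u "[x]" v] u p by simp
      qed
      moreover have "[] \<in> g p" using u by simp
      ultimately show ?thesis using p unfolding E_def by blast
    qed
    show "\<exists>x y q r. x \<noteq> y \<and> (p, x, q) \<in> E \<and> (p, y, r) \<in> E" if p: "p < n" for p
    proof -
      obtain u where u: "u \<in> L" "g p = {v. u @ v \<in> L}" using gQ p by blast
      have "\<exists>x y. x \<noteq> y \<and> u @ [x] \<in> L \<and> u @ [y] \<in> L"
      proof (cases u rule: rev_cases)
        case Nil
        \<comment> \<open>The extension property needs a preceding letter, so the detour through
          \<open>a0\<close> supplies one. The letter \<open>b\<close> found behind it differs from
          \<open>a0\<close>, and deleting the detour brings it to the front.\<close>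
        have "[a0] @ [bar a0] \<in> L" using insert[OF a0 \<open>[] \<in> L\<close>] by simp
        then obtain b where "b \<noteq> a0" "[a0, bar a0, b] \<in> L" using extend[of "[a0]" "bar a0"] by auto
        then show ?thesis using delete[of "[]" "[a0]" "[b]"] a0 Nil by auto
      next
        case (snoc u' a)
        \<comment> \<open>One of the two letters continues \<open>u\<close>; the other,
          \<open>bar a\<close>, reverses its last letter.\<close>
        then obtain b where "b \<noteq> bar a" "u @ [b] \<in> L" using extend[of u' a] u by auto
        moreover have "u @ [bar a] \<in> L"
          using insert[OF u(1) \<open>[] \<in> L\<close>] prefix[of "u @ [bar a]" "bar_word u'"] snoc by simp
        ultimately show ?thesis by blast
      qed
      then obtain x y where "x \<noteq> y" "[x] \<in> g p" "[y] \<in> g p" using u by auto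
      then show ?thesis using path_ex[of "[x]" p] path_ex[of "[y]" p] p by auto
    qed
  qed
  then show thesis using that lang[OF i(1)] i(2) by blast
qed

section \<open>Minimality of the core automaton, and reduced paths in it\<close>

context core_automaton
begin

text \<open>The core automaton is trim and has no states to merge. The detour through
  \<open>merge_states\<close> is due to the definition of the minimal automaton, which has classes
  as its states.\<close>

lemma minimal_automaton_exists:
  assumes L: "L = {w. \<exists>q. path E i w q}"
  shows "\<exists>M. minimal_automaton (letters A) L M \<and> i_automaton A M \<and> accepting M = states M \<and>
    two_letters_everywhere M"
proof -
  define B where "B = \<lparr>states = {..<n}, initial = i, transitions = E, accepting = {..<n}\<rparr>"
  have iB: "i_automaton A B"
    using initial E_subset edge_bar[of _ "Inl _"] edge_bar[of _ "Inr _"]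
    unfolding i_automaton_def automaton_over_def by (auto simp: B_def dest: edge_unique)
  then have aut: "automaton_over (letters A) B" by (simp add: i_automaton_def)
  have end_in: "q < n" if "path E p w q" "p < n" for p w q
    using path_in_verts[OF that(1), of "{..<n}"] that(2) E_subset by auto
  have lang: "language_from B p = {w. \<exists>q. path E p w q}" if "p < n" for p
    using end_in that by (auto simp: language_from_def B_def)
  have two: "two_letters_everywhere B"
    using two_letters by (auto simp: two_letters_everywhere_def B_def)
  have "trim B"
    using reachable by (auto simp: trim_def B_def intro!: exI[of _ "[]"])
  moreover have "accepted_language B = L"
    using L lang[OF initial] by (simp add: accepted_language_def) (simp add: B_def)
  ultimately have "minimal_automaton (letters A) L (merge_states B)"
    using aut unfolding minimal_automaton_def by blast
  moreover have "p = q" if "p \<in> states B" "q \<in> states B" "language_from B p = language_from B q" for p q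
    using that distinct_languages lang by (simp add: B_def)
  ultimately show ?thesis
    using i_automaton_merge_states[OF iB _ two] by (auto simp: B_def)
qed

text \<open>At each step at most one of two available letters cancels against the last letter
  written. The word \<open>w\<close> need not label a path ending at \<open>p\<close>.\<close>

lemma reduced_extension:
  assumes "p < n" "reduced w"
  shows "\<exists>v q. length v = m \<and> q < n \<and> path E p v q \<and> reduced (w @ v)"
  using assms
proof (induction m arbitrary: p w)
  case (Suc m)
  obtain x q where x: "(p, x, q) \<in> E" "w = [] \<or> x \<noteq> bar (last w)"
    using two_letters[OF Suc.prems(1)] by metis
  then have "reduced (w @ [x])" "q < n"
    using Suc.prems E_subset by (auto simp: reduced_append reduced_Cons)
  then obtain v r where "length v = m" "r < n" "path E q v r" "reduced ((w @ [x]) @ v)"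
    using Suc.IH by blast
  then show ?case using x by (intro exI[of _ "x # v"] exI[of _ r]) auto
qed auto

text \<open>Reversed access paths lead back to \<open>i\<close>. There are finitely many, and the
  sum of their lengths bounds each of them.\<close>

lemma bounded_returns: "\<exists>D. \<forall>p<n. \<exists>r. path E p r i \<and> length r \<le> D"
proof -
  obtain f where f: "\<And>p. p < n \<Longrightarrow> path E i (f p) p" using reachable by metis
  have "path E p (bar_word (f p)) i \<and> length (bar_word (f p)) \<le> (\<Sum>p<n. length (f p))" if "p < n" for p
    using f[OF that] that by (auto intro: path_bar_word member_le_sum)
  then show ?thesis by blast
qed

text \<open>Readability of reduced forms is passed on to the words themselves, one letter at a time.
  Either \<open>x\<close> cancels, and the last edge of the reduced path is traversed backwards, or
  \<open>x\<close> is the last letter of the reduced form.\<close>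

lemma path_snoc_of_reduce:
  assumes u: "path E p u q" and ux: "path E p (reduce (u @ [x])) s"
  shows "\<exists>s. path E p (u @ [x]) s"
proof -
  have u': "path E p (reduce u) q" using u by (rule path_reduce)
  have "\<exists>s. (q, x, s) \<in> E"
  proof (cases "reduce u \<noteq> [] \<and> last (reduce u) = bar x")
    case True
    then have "path E p (butlast (reduce u) @ [bar x]) q" using u' by (metis append_butlast_last_id)
    then show ?thesis using edge_bar by (fastforce simp: path_append)
  next
    case False
    then have "reduce (u @ [x]) = reduce u @ [x]"
      using reduce_snoc[OF reduced_reduce, of u x] by auto
    then show ?thesis using ux u' by (auto simp: path_append dest: path_unique)
  qed
  then show ?thesis using u by (auto simp: path_append)
qed

end

section \<open>Attaching a tail\<close>

text \<open>By \<open>tail_end\<close> the reverse of the last tail edge does not compete with a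
  core edge at \<open>i\<close>, so that the graph remains folded after the tail has been
  attached.\<close>

locale tailed_core_automaton = core_automaton E A n i for E :: "(nat \<times> ('a + 'a) \<times> nat) set" and A n i +
  fixes t :: "('a + 'a) list"
  assumes tail: "t \<in> carrier (free_group A)"
    and tail_end: "t \<noteq> [] \<Longrightarrow> (i, bar (last t), q) \<notin> E"
begin

text \<open>The vertices along the path labeled \<open>t\<close>, whose end is glued to
  \<open>i\<close>. If \<open>t\<close> is empty, position 0 is already \<open>i\<close>.\<close>

definition tail_vertex :: "nat \<Rightarrow> nat" where
  "tail_vertex j = (if j < length t then n + j else i)"

definition tailed_edges :: "(nat \<times> ('a + 'a) \<times> nat) set" where
  "tailed_edges = E \<union> {(tail_vertex j, t ! j, tail_vertex (Suc j)) | j. j < length t}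
     \<union> {(tail_vertex (Suc j), bar (t ! j), tail_vertex j) | j. j < length t}"

definition tailed_graph :: "(nat, 'a) pointed_graph" where
  "tailed_graph = \<lparr>verts = {..<n + length t},
     edges = {(p, a, q). (p, Inl a, q) \<in> tailed_edges}, base = tail_vertex 0\<rparr>"

abbreviation "F \<equiv> tailed_edges"
abbreviation "\<Gamma> \<equiv> tailed_graph"
abbreviation "b \<equiv> tail_vertex 0"

lemma reduced_tail: "reduced t"
  using tail by (simp add: carrier_free_group)

lemma tail_letter: "j < length t \<Longrightarrow> t ! j \<in> letters A"
  using tail by (auto simp: carrier_free_group)

section \<open>The edges of the tailed graph\<close>

lemma tail_no_cancel:
  assumes "Suc j < length t"
  shows "t ! Suc j \<noteq> bar (t ! j)"
proof
  assume "t ! Suc j = bar (t ! j)"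
  then have "t = take j t @ [t ! j, bar (t ! j)] @ drop (Suc (Suc j)) t"
    using assms by (metis Cons_nth_drop_Suc Suc_lessD append_Cons append_Nil append_take_drop_id)
  then show False using reduced_tail unfolding reduced_def by blast
qed

lemma F_bar: "(p, x, q) \<in> F \<Longrightarrow> (q, bar x, p) \<in> F"
  by (auto simp: tailed_edges_def edge_bar)

lemma F_tail_iff:
  assumes "j < length t"
  shows "(n + j, x, q) \<in> F \<longleftrightarrow> x = t ! j \<and> q = tail_vertex (Suc j) \<or>
    0 < j \<and> x = bar (t ! (j - 1)) \<and> q = n + (j - 1)"
proof -
  have "(n + j, x, q) \<notin> E" using E_subset by auto
  moreover have "tail_vertex k = n + j \<longleftrightarrow> k = j" for k
    using assms initial by (auto simp: tail_vertex_def)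
  moreover have "(\<exists>k. k < length t \<and> Suc k = j \<and> x = bar (t ! k) \<and> q = tail_vertex k) \<longleftrightarrow>
      0 < j \<and> x = bar (t ! (j - 1)) \<and> q = n + (j - 1)"
    using assms by (cases j) (auto simp: tail_vertex_def)
  ultimately show ?thesis
    using assms unfolding tailed_edges_def by (simp; metis)
qed

lemma F_core_iff:
  assumes "p < n"
  shows "(p, x, q) \<in> F \<longleftrightarrow> (p, x, q) \<in> E \<or>
    t \<noteq> [] \<and> p = i \<and> x = bar (last t) \<and> q = n + (length t - 1)"
proof -
  have "(\<exists>j. j < length t \<and> p = tail_vertex (Suc j) \<and> x = bar (t ! j) \<and> q = tail_vertex j) \<longleftrightarrow>
      t \<noteq> [] \<and> p = i \<and> x = bar (last t) \<and> q = n + (length t - 1)" (is "?l \<longleftrightarrow> ?r")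
  proof
    assume ?l
    then obtain j where j: "j < length t" "p = tail_vertex (Suc j)" "x = bar (t ! j)" "q = tail_vertex j"
      by blast
    then have "length t = Suc j" using assms by (auto simp: tail_vertex_def split: if_splits)
    moreover have "t \<noteq> []" using j(1) by auto
    ultimately show ?r using j by (auto simp: tail_vertex_def last_conv_nth)
  next
    assume ?r
    then show ?l by (intro exI[of _ "length t - 1"]) (auto simp: tail_vertex_def last_conv_nth)
  qed
  moreover have "j < length t \<Longrightarrow> tail_vertex j \<noteq> p" for j using assms by (simp add: tail_vertex_def)
  ultimately show ?thesis unfolding tailed_edges_def by auto
qed

lemma vertex_cases:
  assumes "p < n + length t"
  obtains (core) "p < n" | (tail) j where "j < length t" "p = n + j"
proof (cases "p < n")
  case False
  then show thesis using assms tail[of "p - n"] by simp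
qed (rule core)

lemma tail_vertex_less: "tail_vertex j < n + length t"
  using initial by (simp add: tail_vertex_def)

lemma F_subset: "F \<subseteq> {..<n + length t} \<times> letters A \<times> {..<n + length t}"
  using E_subset tail_letter tail_vertex_less by (auto simp: tailed_edges_def)

text \<open>Determinism at \<open>i\<close> comes from \<open>tail_end\<close>, and at the inner
  vertices of the tail from the reducedness of \<open>t\<close>.\<close>

sublocale F: involutive_graph F
proof
  fix p x q q' assume pq: "(p, x, q) \<in> F" "(p, x, q') \<in> F"
  then have "p < n + length t" using F_subset by auto
  then show "q = q'"
  proof (cases rule: vertex_cases)
    case core
    then show ?thesis using pq tail_end by (auto simp: F_core_iff dest: edge_unique)
  next
    case (tail j)
    then show ?thesis using pq tail_no_cancel[of "j - 1"] by (auto simp: F_tail_iff)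
  qed
qed (rule F_bar)

lemma two_way_edges: "two_way (edges \<Gamma>) = F"
proof -
  have "(p, x, q) \<in> two_way (edges \<Gamma>) \<longleftrightarrow> (p, x, q) \<in> F" for p x q
    using F_bar[of p x q] F_bar[of q "bar x" p] by (cases x) (auto simp: tailed_graph_def)
  then show ?thesis by auto
qed

sublocale folded: folded_graph \<Gamma> A
proof
  show "edges \<Gamma> \<subseteq> verts \<Gamma> \<times> A \<times> verts \<Gamma>"
    using F_subset by (auto simp: tailed_graph_def letters_def)
  show "p = p'" if "(p, a, q) \<in> edges \<Gamma>" "(p', a, q) \<in> edges \<Gamma>" for p p' a q
    using that F.edge_unique[of q "Inr a" p p'] F_bar[of p "Inl a" q] F_bar[of p' "Inl a" q]
    by (simp add: tailed_graph_def)
qed (use finite_letters tail_vertex_less F.edge_unique in \<open>auto simp: tailed_graph_def\<close>)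

section \<open>Paths and degrees in the tailed graph, and the identification of its tail and
  core\<close>

lemma path_tail_take: "j \<le> length t \<Longrightarrow> path F b (take j t) (tail_vertex j)"
proof (induction j)
  case (Suc j)
  then have "(tail_vertex j, t ! j, tail_vertex (Suc j)) \<in> F" by (auto simp: tailed_edges_def)
  then show ?case using Suc by (auto simp: take_Suc_conv_app_nth path_append)
qed simp

lemma path_tail: "path F b t i"
  using path_tail_take[of "length t"] by (simp add: tail_vertex_def)

lemma E_subset_F: "E \<subseteq> F"
  by (auto simp: tailed_edges_def)

lemma path_from_base:
  assumes "p < n + length t"
  shows "\<exists>w. path F b w p"
  using assms
proof (cases rule: vertex_cases)
  case core
  then obtain w where "path E i w p" using reachable by blast
  then have "path F b (t @ w) p" using path_tail path_mono[OF _ E_subset_F] by (auto simp: path_append)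
  then show ?thesis by blast
next
  case (tail j)
  then show ?thesis using path_tail_take[of j] by (auto simp: tail_vertex_def)
qed

text \<open>An edge advances at most one position along the tail. For a path from the base this says
  that \<open>t\<close> is a shortest word leading into the core.\<close>

lemma path_from_tail_length: "path F p s q \<Longrightarrow> p = n + j \<Longrightarrow> q < n \<Longrightarrow> length t \<le> j + length s"
proof (induction s arbitrary: p j)
  case (Cons x s)
  show ?case
  proof (cases "j < length t")
    case True
    obtain r where r: "(n + j, x, r) \<in> F" "path F r s q" using Cons.prems by auto
    then consider "r = n + Suc j" | "Suc j = length t" | "0 < j" "r = n + (j - 1)"
      using True by (auto simp: F_tail_iff tail_vertex_def split: if_splits)
    then show ?thesis using Cons.IH[OF r(2) _ Cons.prems(3)] by cases fastforce+
  qed auto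
qed auto

text \<open>The edge of the tail raises the degree of \<open>i\<close> to at least 3. This is what
  makes the tail, in the sense of \<open>tail_verts\<close>, stop before \<open>i\<close>.\<close>

lemma degree_core:
  assumes "p < n"
  shows "(if p = i \<and> t \<noteq> [] then 3 else 2) \<le> degree \<Gamma> p"
proof -
  obtain x y q r where xy: "x \<noteq> y" "(p, x, q) \<in> E" "(p, y, r) \<in> E"
    using two_letters[OF assms] by blast
  show ?thesis
  proof (cases "p = i \<and> t \<noteq> []")
    case True
    then have "bar (last t) \<noteq> x" "bar (last t) \<noteq> y" using xy tail_end by auto
    moreover have "card {x, y, bar (last t)} \<le> degree \<Gamma> p"
      by (rule folded.degree_ge) (use xy True assms in \<open>auto simp: two_way_edges F_core_iff\<close>)
    ultimately show ?thesis using xy(1) True by simp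
  next
    case False
    have "card {x, y} \<le> degree \<Gamma> p"
      by (rule folded.degree_ge) (use xy assms in \<open>auto simp: two_way_edges F_core_iff\<close>)
    then show ?thesis using xy(1) False by auto
  qed
qed

lemma degree_tail:
  assumes "j < length t"
  shows "degree \<Gamma> (n + j) = (if j = 0 then 1 else 2)"
proof -
  have "{x. \<exists>q. (n + j, x, q) \<in> F} = (if j = 0 then {t ! 0} else {t ! j, bar (t ! (j - 1))})"
    using assms by (auto simp: F_tail_iff)
  then show ?thesis
    using tail_no_cancel[of "j - 1"] assms by (auto simp: folded.degree_eq_card_letters two_way_edges)
qed

lemma verts_base: "verts \<Gamma> = {..<n + length t}" "base \<Gamma> = b"
  by (simp_all add: tailed_graph_def)

lemma cyclically_reduced_iff: "cyclically_reduced \<Gamma> \<longleftrightarrow> t = []"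
proof
  assume cr: "cyclically_reduced \<Gamma>"
  show "t = []"
  proof (rule ccontr)
    assume "t \<noteq> []"
    then have "degree \<Gamma> n = 1" "n \<in> verts \<Gamma>" using degree_tail[of 0] by (auto simp: verts_base)
    then show False using cr by (auto simp: cyclically_reduced_def)
  qed
next
  assume "t = []"
  then show "cyclically_reduced \<Gamma>"
    unfolding cyclically_reduced_def verts_base
  proof (intro ballI)
    fix v assume "v \<in> {..<n + length t}"
    then have "v < n" using \<open>t = []\<close> by simp
    from degree_core[OF this] show "2 \<le> degree \<Gamma> v" by (simp split: if_splits)
  qed
qed

text \<open>The rule \<open>step\<close> can only enter vertices of degree 2, so it cannot pass
  through \<open>i\<close>, the only exit from the attached path.\<close>

lemma tail_verts_eq:
  assumes "t \<noteq> []"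
  shows "tail_verts \<Gamma> = {n..<n + length t}"
proof
  show "tail_verts \<Gamma> \<subseteq> {n..<n + length t}"
  proof
    fix v assume "v \<in> tail_verts \<Gamma>"
    then show "v \<in> {n..<n + length t}"
    proof induction
      case base
      then show ?case using assms by (simp add: verts_base tail_vertex_def)
    next
      case (step p x q)
      then have "p < n + length t" "\<not> p < n" by auto
      then obtain j where j: "j < length t" "p = n + j" by (auto elim: vertex_cases)
      moreover have "q \<noteq> i" using degree_core[OF initial] assms step.hyps(3) by auto
      ultimately show ?case using step.hyps(2)
        by (auto simp: two_way_edges F_tail_iff tail_vertex_def split: if_splits)
    qed
  qed
  have "n + j \<in> tail_verts \<Gamma>" if "j < length t" for j
    using that
  proof (induction j)
    case 0
    then show ?case using tail_verts.base[of \<Gamma>] by (simp add: verts_base tail_vertex_def)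
  next
    case (Suc j)
    then have "(n + j, t ! j, n + Suc j) \<in> two_way (edges \<Gamma>)"
      by (simp add: two_way_edges F_tail_iff tail_vertex_def)
    from tail_verts.step[OF _ this] show ?case using Suc degree_tail[OF Suc.prems] by simp
  qed
  then show "{n..<n + length t} \<subseteq> tail_verts \<Gamma>"
    by (metis atLeastLessThan_iff le_iff_add nat_add_left_cancel_less subsetI)
qed

lemma core_verts_eq: "core_verts \<Gamma> = {..<n}"
  unfolding core_verts_def cyclically_reduced_iff verts_base using tail_verts_eq by auto

lemma core_language_eq: "core_language \<Gamma> i = {w. \<exists>q. path E i w q}"
proof -
  have "two_way (core_edges \<Gamma>) = E"
    unfolding folded.two_way_core_edges two_way_edges core_verts_eq
    using E_subset by (auto simp: F_core_iff)
  then show ?thesis by (simp add: core_language_def)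
qed

lemma tail_word_tail: "tail_word \<Gamma> t i"
proof (cases "t = []")
  case True
  moreover from this have "b = i" unfolding tail_vertex_def by simp
  ultimately show ?thesis unfolding tail_word_def cyclically_reduced_iff verts_base by metis
next
  case False
  then have "b = n + 0" by (simp add: tail_vertex_def)
  then show ?thesis
    using False path_tail initial path_from_tail_length[of b _ _ 0]
    by (auto simp: tail_word_def cyclically_reduced_iff core_verts_eq two_way_edges verts_base)
qed

text \<open>This is the subgroup \<open>H\<close> of the overview.\<close>

definition loops :: "('a + 'a) list set" where
  "loops = {w. reduced w \<and> path F b w b}"

lemma stallings_graph_loops: "stallings_graph A loops \<Gamma>"
proof -
  have "\<exists>w. path F p w q" if pq: "p \<in> verts \<Gamma>" "q \<in> verts \<Gamma>" for p q
  proof -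
    obtain u v where "path F b u p" "path F b v q" 
      using pq path_from_base[of p] path_from_base[of q] unfolding verts_base by blast
    then have "path F p (bar_word u @ v) q" using F.path_bar_word by (auto simp: path_append)
    then show ?thesis by blast
  qed
  moreover have "2 \<le> degree \<Gamma> v" if v: "v \<in> verts \<Gamma> - {base \<Gamma>}" for v
  proof -
    from v have "v < n + length t" by (simp add: verts_base)
    then show ?thesis
    proof (cases rule: vertex_cases)
      case core
      then show ?thesis using degree_core[of v] by (simp split: if_splits)
    next
      case (tail j)
      then have "j \<noteq> 0"
        using v by (intro notI) (auto simp: verts_base tail_vertex_def split: if_splits)
      then show ?thesis using degree_tail tail by simp
    qed
  qed
  ultimately show ?thesis
    unfolding stallings_graph_def two_way_edges
    using folded.finite_verts folded.edges_subset folded.base_in_verts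
      folded.out_unique folded.in_unique
    by (auto simp: loops_def verts_base(2))
qed

lemma fin_gen_loops: "fin_gen_subgroup A loops"
  unfolding loops_def
proof (rule F.fin_gen_subgroup_loops)
  show "finite F"
    using finite_letters by (intro finite_subset[OF F_subset]) (simp add: letters_def)
  show "\<exists>w. path F b w p" if "(p, x, q) \<in> F" for p x q
    using that F_subset path_from_base by blast
qed (use F_subset in auto)

lemma tail_and_core_language_loops: "tail_and_core_language A loops t {w. \<exists>q. path E i w q}"
  unfolding tail_and_core_language_def
  using stallings_graph_loops tail_word_tail core_language_eq by blast

text \<open>
  Collapsing the tail onto \<open>i\<close> turns a path of the tailed graph into a path of the core whose label
  is the same element of the free group up to the parts of the tail at both ends.
\<close>

lemma path_collapse_tail:
  assumes "path F p z q"
  shows "\<exists>w. path E (if p < n then p else i) w (if q < n then q else i) \<and>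
    reduce (z @ drop (q - n) (if q < n then [] else t)) = reduce (drop (p - n) (if p < n then [] else t) @ w)"
  using assms
proof (induction z arbitrary: p)
  case Nil
  then show ?case by (intro exI[of _ "[]"]) auto
next
  case (Cons x z)
  \<comment> \<open>Collapsing sends \<open>p\<close> to \<open>e p\<close>, and
    \<open>\<rho> p\<close> is the label of the way from \<open>p\<close> along the tail to
    \<open>i\<close>, empty for a core vertex.\<close>
  define e where "e p = (if p < n then p else i)" for p
  define \<rho> where "\<rho> p = drop (p - n) (if p < n then [] else t)" for p
  obtain r where r: "(p, x, r) \<in> F" "path F r z q" using Cons.prems by auto
  obtain w where w: "path E (e r) w (e q)" "reduce (z @ \<rho> q) = reduce (\<rho> r @ w)"
    using Cons.IH[OF r(2)] unfolding e_def \<rho>_def by blast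
  \<comment> \<open>It suffices to treat a single edge: a core edge is kept with
    \<open>w' = [x]\<close>, while an edge of the tail, in either direction, only lengthens or
    shortens the remaining way and collapses to the empty path.\<close>
  have "\<exists>w'. path E (e p) w' (e r) \<and> reduce ([x] @ \<rho> r) = reduce (\<rho> p @ w')"
  proof -
    have "p < n + length t" using r F_subset by auto
    then show ?thesis
    proof (cases rule: vertex_cases)
      case core
      show ?thesis
      proof (cases "(p, x, r) \<in> E")
        case True
        then have "r < n" using E_subset by auto
        then show ?thesis using core True by (intro exI[of _ "[x]"]) (auto simp: e_def \<rho>_def)
      next
        case False
        then have t: "t \<noteq> []" and p: "p = i" and x: "x = bar (last t)" and r: "r = n + (length t - 1)"
          using core r(1) by (auto simp: F_core_iff)
        have "drop (length t - 1) t = [last t]"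
          using t by (cases t rule: rev_cases) auto
        then have "reduce ([x] @ \<rho> r) = reduce (bar_word [last t] @ [last t])"
          unfolding \<rho>_def r x by simp
        then have "reduce ([x] @ \<rho> r) = []" by (simp only: reduce_bar_word)
        then show ?thesis
          using core p r by (intro exI[of _ "[]"]) (auto simp: e_def \<rho>_def)
      qed
    next
      case (tail j)
      then consider "x = t ! j" "r = tail_vertex (Suc j)" | "0 < j" "x = bar (t ! (j - 1))" "r = n + (j - 1)"
        using r(1) by (auto simp: F_tail_iff)
      then show ?thesis
      proof cases
        case 1
        have "\<rho> r = drop (Suc j) t" "e r = i" using 1 initial by (auto simp: tail_vertex_def e_def \<rho>_def)
        then have "[x] @ \<rho> r = \<rho> p" "e p = i"
          using tail 1 by (simp_all add: \<rho>_def e_def Cons_nth_drop_Suc)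
        then show ?thesis using \<open>e r = i\<close> by (intro exI[of _ "[]"]) auto
      next
        case 2
        have "drop (j - 1) t = t ! (j - 1) # drop j t"
          using 2(1) tail(1) Cons_nth_drop_Suc[of "j - 1" t] by simp
        then have "[x] @ \<rho> r = bar_word [t ! (j - 1)] @ [t ! (j - 1)] @ drop j t"
          using 2 by (simp add: \<rho>_def)
        then have "reduce ([x] @ \<rho> r) = reduce (\<rho> p)"
          using reduce_delete(2)[of "[]" "[t ! (j - 1)]" "drop j t"] tail by (simp add: \<rho>_def)
        then show ?thesis using 2 tail by (intro exI[of _ "[]"]) (auto simp: e_def)
      qed
    qed
  qed
  then obtain w' where w': "path E (e p) w' (e r)" "reduce ([x] @ \<rho> r) = reduce (\<rho> p @ w')" by blast
  have "reduce ((x # z) @ \<rho> q) = reduce ([x] @ \<rho> r @ w)"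
    using reduce_mid_cong[OF w(2), of "[x]" "[]"] by simp
  also have "\<dots> = reduce (\<rho> p @ w' @ w)"
    using reduce_mid_cong[OF w'(2), of "[]" w] by simp
  finally show ?case
    using w w' unfolding e_def[symmetric] \<rho>_def[symmetric]
    by (intro exI[of _ "w' @ w"]) (auto simp: path_append)
qed

lemma loops_core:
  assumes "h \<in> loops"
  shows "\<exists>w. path E i w i \<and> reduce (h @ t) = reduce (t @ w)"
proof -
  have "path F b h b" using assms by (simp add: loops_def)
  moreover have "drop (b - n) (if b < n then [] else t) = t" "(if b < n then b else i) = i"
    using initial by (auto simp: tail_vertex_def)
  ultimately show ?thesis using path_collapse_tail[of b h b] by simp
qed

text \<open>The converse of \<open>loops_core\<close>: together they say that \<open>loops\<close>
  is the group of loops of the core at \<open>i\<close>, conjugated by \<open>t\<close>.\<close>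

lemma core_loop:
  assumes "path E i w i"
  shows "reduce (t @ w @ bar_word t) \<in> loops"
proof -
  have "path F b (t @ w @ bar_word t) b"
    using path_tail F.path_bar_word[OF path_tail] path_mono[OF assms E_subset_F]
    by (auto simp: path_append)
  then show ?thesis by (simp add: loops_def reduced_reduce F.path_reduce)
qed

end

section \<open>Maximality under finite index\<close>

text \<open>Pick one representative in each of the finitely many cosets. If \<open>k\<close> lies in
  the coset of \<open>r\<close>, then multiplying \<open>k\<close> by the inverse of
  \<open>r\<close> gives an element of \<open>H\<close>.\<close>

lemma bounded_coset_representatives:
  assumes K: "subgroup K (free_group A)" and H: "[] \<in> H" "\<And>h. h \<in> H \<Longrightarrow> reduced h"
    and fin: "finite (rcosets\<^bsub>(free_group A)\<lparr>carrier := K\<rparr>\<^esub> H)"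
  shows "\<exists>M. \<forall>k\<in>K. \<exists>r\<in>K. length r \<le> M \<and> reduce (k @ bar_word r) \<in> H"
proof -
  let ?K = "(free_group A)\<lparr>carrier := K\<rparr>"
  define f where "f C = (SOME r. r \<in> K \<and> C = H #>\<^bsub>?K\<^esub> r)" for C
  define M where "M = (\<Sum>C\<in>rcosets\<^bsub>?K\<^esub> H. length (f C))"
  have K_red: "k \<in> K \<Longrightarrow> reduced k" for k
    using subgroup.subset[OF K] by (auto simp: carrier_free_group)
  have coset: "H #>\<^bsub>?K\<^esub> k = (\<lambda>h. reduce (h @ k)) ` H" for k
    by (auto simp: r_coset_def)
  have "\<exists>r\<in>K. length r \<le> M \<and> reduce (k @ bar_word r) \<in> H" if k: "k \<in> K" for k
  proof -
    define C where "C = H #>\<^bsub>?K\<^esub> k"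
    have C: "C \<in> rcosets\<^bsub>?K\<^esub> H" using k by (auto simp: C_def RCOSETS_def)
    have fC: "f C \<in> K" "C = H #>\<^bsub>?K\<^esub> f C"
      using someI[of "\<lambda>r. r \<in> K \<and> C = H #>\<^bsub>?K\<^esub> r" k] k unfolding C_def f_def by blast+
    have "reduce ([] @ k) \<in> C"
      using H(1) unfolding C_def coset by blast
    then have "k \<in> C" using K_red[OF k] by (simp add: reduce_eq_self)
    then obtain h where h: "h \<in> H" "k = reduce (h @ f C)"
      using fC(2) unfolding coset by auto
    have "reduce (k @ bar_word (f C)) = reduce h"
      using reduce_delete(1)[of h "f C" "[]"] h(2) by simp
    then have "reduce (k @ bar_word (f C)) \<in> H" using h(1) H(2) by (simp add: reduce_eq_self)
    moreover have "length (f C) \<le> M"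
      unfolding M_def using C fin by (intro member_le_sum[of C _ "\<lambda>C. length (f C)"]) auto
    ultimately show ?thesis using fC(1) by blast
  qed
  then show ?thesis by blast
qed

context tailed_core_automaton
begin

lemma fi_maximal_loops: "fi_maximal A loops"
proof -
  have "K \<subseteq> loops"
    if K: "subgroup K (free_group A)" and sub: "loops \<subseteq> K"
      and fin: "finite (rcosets\<^bsub>(free_group A)\<lparr>carrier := K\<rparr>\<^esub> loops)" for K
  proof -
    have K_red: "k \<in> K \<Longrightarrow> reduced k" for k
      using subgroup.subset[OF K] by (auto simp: carrier_free_group)
    have K_mult: "reduce (u @ v) \<in> K" if "u \<in> K" "v \<in> K" for u v
      using subgroup.m_closed[OF K that] by simp
    have K_inv: "bar_word u \<in> K" if "u \<in> K" for u
      using subgroup.m_inv_closed[OF K that] subgroup.subset[OF K] that by (auto simp: inv_free_group)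
    have "[] \<in> loops" "\<And>h. h \<in> loops \<Longrightarrow> reduced h" by (simp_all add: loops_def)
    then obtain M where M: "\<And>k. k \<in> K \<Longrightarrow> \<exists>r\<in>K. length r \<le> M \<and> reduce (k @ bar_word r) \<in> loops"
      using bounded_coset_representatives[OF K _ _ fin] by blast
    obtain D where D: "\<And>p. p < n \<Longrightarrow> \<exists>r. path E p r i \<and> length r \<le> D"
      using bounded_returns by blast
    have reduced_readable: "\<exists>q. path E i (reduce (bar_word t @ k @ t @ v)) q"
      if k: "k \<in> K" and v: "path E i v p" for k v p
    proof -
      define u where "u = reduce (bar_word t @ k @ t @ v)"
      have "p < n" using path_in_verts[OF v, of "{..<n}"] initial E_subset by auto
      \<comment> \<open>The length is the sum of the bounds for the four words to be appended: the
        return \<open>r\<close> to \<open>i\<close>, the inverse of \<open>t\<close>, the inverse of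
        a coset representative \<open>s\<close>, and \<open>t\<close>. Hence they cannot cancel into
        \<open>u\<close>.\<close>
      then obtain v' p' where v': "length v' = D + length t + M + length t" "p' < n" "path E p v' p'"
        "reduced (u @ v')"
        using reduced_extension[OF \<open>p < n\<close>, of u] reduced_reduce unfolding u_def by blast
      obtain r where r: "path E p' r i" "length r \<le> D" using D v'(2) by blast
      have "reduce (t @ (v @ v' @ r) @ bar_word t) \<in> loops"
        by (rule core_loop) (use v v' r in \<open>auto simp: path_append\<close>)
      then have "reduce (k @ t @ v @ v' @ r @ bar_word t) \<in> K"
        using K_mult[OF k] sub by fastforce
      then obtain s where s: "length s \<le> M" "reduce (k @ t @ v @ v' @ r @ bar_word t @ bar_word s) \<in> loops"
        using M by fastforce
      then obtain w where w: "path E i w i"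
        "reduce (k @ t @ v @ v' @ r @ bar_word t @ bar_word s @ t) = reduce (t @ w)"
        using loops_core by fastforce
      \<comment> \<open>Solving for \<open>w\<close> shows that \<open>u\<close> is a prefix of the
        reduced form of a loop at \<open>i\<close>, and is therefore readable from
        \<open>i\<close>.\<close>
      have "reduce w = reduce (bar_word t @ t @ w)" using reduce_delete(2)[of "[]" t w] by simp
      also have "\<dots> = reduce (bar_word t @ reduce (t @ w))" by simp
      also have "\<dots> = reduce (bar_word t @ k @ t @ v @ v' @ r @ bar_word t @ bar_word s @ t)"
        unfolding w(2)[symmetric] by simp
      also have "\<dots> = reduce (u @ v' @ (r @ bar_word t @ bar_word s @ t))"
        by (simp add: u_def)
      finally obtain y where "reduce w = u @ y"
        using reduce_append_short[OF v'(4), of "r @ bar_word t @ bar_word s @ t"] v'(1) r(2) s(1) by auto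
      then show ?thesis using path_reduce[OF w(1)] unfolding u_def[symmetric] by (auto simp: path_append)
    qed
    \<comment> \<open>The element \<open>k\<close> as seen from the end \<open>i\<close> of the tail
      instead of the base.\<close>
    define \<kappa> where "\<kappa> k = reduce (bar_word t @ k @ t)" for k
    \<comment> \<open>The word itself, and not only its reduced form, has to be readable: otherwise
      the state reached by \<open>\<kappa> k\<close> could not be compared with
      \<open>i\<close>.\<close>
    have readable: "\<exists>q. path E i (\<kappa> k @ v) q" if k: "k \<in> K" and v: "path E i v p" for k v p
      using v
    proof (induction v arbitrary: p rule: rev_induct)
      case Nil
      then show ?case using reduced_readable[OF k, of "[]" i] by (simp add: \<kappa>_def)
    next
      case (snoc x v)
      obtain p' where "path E i v p'" using snoc.prems by (auto simp: path_append)
      then obtain q where q: "path E i (\<kappa> k @ v) q" using snoc.IH by blast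
      have "reduce ((\<kappa> k @ v) @ [x]) = reduce (bar_word t @ k @ t @ v @ [x])" by (simp add: \<kappa>_def)
      then show ?case
        using path_snoc_of_reduce[OF q, of x] reduced_readable[OF k snoc.prems] by auto
    qed
    show "K \<subseteq> loops"
    proof
      fix k assume k: "k \<in> K"
      obtain q where q: "path E i (\<kappa> k) q" using readable[OF k, of "[]" i] by auto
      have "q < n" using path_in_verts[OF q, of "{..<n}"] initial E_subset by auto
      \<comment> \<open>For the second inclusion the argument is applied to the inverse of
        \<open>k\<close>: the path labeled \<open>\<kappa> (bar_word k) @ \<kappa> k\<close> has
        trivial label in the group, so it ends at \<open>i\<close>, where \<open>v\<close> can then
        be read.\<close>
      have cancel: "reduce (\<kappa> (bar_word k) @ \<kappa> k) = []"
        using reduce_bar_word[of "bar_word t @ k @ t"] by (simp add: \<kappa>_def)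
      have "{w. \<exists>r. path E i w r} = {w. \<exists>r. path E q w r}"
      proof (intro equalityI subsetI; clarify)
        fix v r assume "path E i v r"
        then obtain s where "path E i (\<kappa> k @ v) s" using readable[OF k] by blast
        then show "\<exists>r. path E q v r" using q by (auto simp: path_append dest: path_unique)
      next
        fix v r assume "path E q v r"
        then have "path E i (\<kappa> k @ v) r" using q by (auto simp: path_append)
        then obtain s where "path E i (\<kappa> (bar_word k) @ \<kappa> k @ v) s"
          using readable[OF K_inv[OF k]] by blast
        then obtain m where m: "path E i (\<kappa> (bar_word k) @ \<kappa> k) m" "path E m v s"
          by (auto simp: path_append)
        have "m = i" using path_reduce[OF m(1)] cancel by simp
        then show "\<exists>r. path E i v r" using m(2) by blast
      qed
      then have "i = q" using distinct_languages initial \<open>q < n\<close> by blast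
      then have "reduce (t @ \<kappa> k @ bar_word t) \<in> loops" using q core_loop by blast
      moreover have "reduce (t @ \<kappa> k @ bar_word t) = reduce (t @ bar_word t @ k @ t @ bar_word t)"
        using reduce_mid_cong[of "\<kappa> k" "bar_word t @ k @ t" t "bar_word t"] by (simp add: \<kappa>_def)
      moreover have "\<dots> = k"
        using reduce_delete(1)[of "[]" t "k @ t @ bar_word t"] reduce_delete(1)[of k t "[]"] K_red[OF k]
        by (simp add: reduce_eq_self)
      ultimately show "k \<in> loops" by simp
    qed
  qed
  then show ?thesis
    unfolding fi_maximal_def using fin_gen_loops by blast
qed

end

theorem proposition2p18:
  fixes A :: "'a set" and t :: "('a + 'a) list" and L :: "('a + 'a) list set"
  assumes "finite A"
    and "t \<in> carrier (free_group A)"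
    and "L \<subseteq> lists (letters A)"
    and "rational_language (letters A) L"
  shows
   "let C1 = (\<exists>H. fin_gen_subgroup A H \<and> tail_and_core_language A H t L);
        C2 = (\<exists>H. fin_gen_subgroup A H \<and> fi_maximal A H \<and> tail_and_core_language A H t L);
        C3 = ((\<exists>M :: (nat, 'a + 'a) automaton.
                 i_automaton A M \<and> accepted_language M = L \<and>
                 accepting M = states M \<and> two_letters_everywhere M)
              \<and> tail_compatible A t L);
        C3' = ((\<exists>M. minimal_automaton (letters A) L M \<and>
                 i_automaton A M \<and> accepting M = states M \<and> two_letters_everywhere M)
              \<and> tail_compatible A t L);
        C4 = ((\<forall>u v. u @ v \<in> L \<longrightarrow> u \<in> L) \<and>
              (\<forall>u v. u \<in> L \<and> v \<in> L \<longrightarrow> u @ bar_word u @ v \<in> L) \<and>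
              (\<forall>u v w. u @ v @ bar_word v @ w \<in> L \<longrightarrow> u @ w \<in> L) \<and>
              (\<forall>u. \<forall>a\<in>letters A. u @ [a] \<in> L \<longrightarrow>
                 (\<exists>b\<in>letters A. b \<noteq> bar a \<and> u @ [a, b] \<in> L)) \<and>
              tail_compatible A t L)
    in (C1 \<longleftrightarrow> C2) \<and> (C1 \<longleftrightarrow> C3) \<and> (C1 \<longleftrightarrow> C3') \<and> (C1 \<longleftrightarrow> C4 \<and> \<not> L \<subseteq> {[]})"
proof -
  define C1 where "C1 = (\<exists>H. fin_gen_subgroup A H \<and> tail_and_core_language A H t L)"
  define C2 where
    "C2 = (\<exists>H. fin_gen_subgroup A H \<and> fi_maximal A H \<and> tail_and_core_language A H t L)"
  define C3 where "C3 = ((\<exists>M :: (nat, 'a + 'a) automaton.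
    i_automaton A M \<and> accepted_language M = L \<and> accepting M = states M \<and> two_letters_everywhere M)
    \<and> tail_compatible A t L)"
  define C3' where "C3' = ((\<exists>M. minimal_automaton (letters A) L M \<and>
    i_automaton A M \<and> accepting M = states M \<and> two_letters_everywhere M) \<and> tail_compatible A t L)"
  define C4 where "C4 = (closed_language A L \<and> tail_compatible A t L)"
  \<comment> \<open>The cycle runs from \<open>C2\<close> to \<open>C1\<close>, \<open>C3\<close>,
    the nontrivial \<open>C4\<close>, and back to \<open>C2\<close>. The last construction also
    yields \<open>C3'\<close>, from which \<open>C4\<close> follows because merging states preserves
    the language.\<close>
  have 21: "C2 \<Longrightarrow> C1" unfolding C1_def C2_def by blast
  have 13: C3 if c1: C1
  proof -
    obtain H and \<Gamma> :: "(nat, 'a) pointed_graph" and p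
      where G: "stallings_graph A H \<Gamma>" "tail_word \<Gamma> t p" "L = core_language \<Gamma> p"
      using c1 unfolding C1_def tail_and_core_language_def by blast
    show C3
      using i_automaton_of_core[OF assms(1) G(1,2)] unfolding C3_def G(3)[symmetric] by blast
  qed
  have 34: "C4 \<and> \<not> L \<subseteq> {[]}" if C3
    using that closed_language_i_automaton unfolding C3_def C4_def by blast
  have imp4: "C4 \<and> \<not> L \<subseteq> {[]}" if c3: C3'
  proof -
    obtain M where M: "minimal_automaton (letters A) L M" "i_automaton A M" "accepting M = states M"
      "two_letters_everywhere M" using c3 unfolding C3'_def by blast
    then have "accepted_language M = L"
      using accepted_language_merge_states unfolding minimal_automaton_def by blast
    then show ?thesis using closed_language_i_automaton[OF M(2-4)] c3 unfolding C3'_def C4_def by simp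
  qed
  have 4: "C2 \<and> C3'" if c4: "C4" and nontrivial: "\<not> L \<subseteq> {[]}"
  proof -
    have closed: "closed_language A L" and t: "tail_compatible A t L" using c4 by (auto simp: C4_def)
    obtain E n i where core: "core_automaton E A n i" and L: "L = {w. \<exists>q. path E i w q}"
      using core_automaton_of_closed_language[OF assms(1,3,4) closed nontrivial] by blast
    interpret core_automaton E A n i by (rule core)
    interpret tailed_core_automaton E A n i t
    proof
      show "(i, bar (last t), q) \<notin> E" if "t \<noteq> []" for q
      proof
        assume "(i, bar (last t), q) \<in> E"
        then have "[bar (last t)] \<in> L" by (auto simp: L)
        then show False using t that by (auto simp: tail_compatible_def)
      qed
    qed (rule assms(2))
    have C2
      using fin_gen_loops fi_maximal_loops tail_and_core_language_loops unfolding C2_def L by blast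
    then show ?thesis using minimal_automaton_exists[OF L] t unfolding C3'_def by blast
  qed
  have "(C1 \<longleftrightarrow> C2) \<and> (C1 \<longleftrightarrow> C3) \<and> (C1 \<longleftrightarrow> C3') \<and> (C1 \<longleftrightarrow> C4 \<and> \<not> L \<subseteq> {[]})"
    using 21 13 34 imp4 4 by blast
  then show ?thesis
    unfolding C1_def C2_def C3_def C3'_def C4_def closed_language_def Let_def conj_assoc .
qed

end
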